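(* Let $\ell\in\frac12\mathbb{N}$, $\ell>0$, and let $E$ be the first order matrix-valued differential operator $$E=\left(\frac{d}{dx}\right)A_1(x)+A_0,$$ $$A_1(x)=\sum_{i=0}^{2\ell}\frac{2\ell-i}{2\ell}E_{i,i+1}-\sum_{i=0}^{2\ell}x\,\frac{\ell-i}{\ell}E_{i,i}-\sum_{i=0}^{2\ell}\frac{i}{2\ell}E_{i,i-1},\qquad A_0=\sum_{i=0}^{2\ell}\frac{(2\ell+2)(i-2\ell)}{2\ell}E_{i,i}.$$ Then $E$ is symmetric with respect to the weight $W$ defined in the context; hence $E\in\mathcal D(W)$. Moreover, for every integer $n\ge0$, $$P_n(x)E=\Lambda_n(E)P_n(x),\qquad\Lambda_n(E)=\sum_{i=0}^{2\ell}\left(-\frac{n(\ell-i)}{\ell}+\frac{(2\ell+2)(i-2\ell)}{2\ell}\right)E_{i,i},$$ where $\{P_n\}_{n\ge0}$ is the sequence of monic orthogonal polynomials with respect to $W$.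
   Context: All matrices are $(2\ell+1)\times(2\ell+1)$ with rows and columns indexed by $\{0,\dots,2\ell\}$; $E_{i,j}$ is the elementary matrix, interpreted as $0$ when an index is out of range. $(a)_k=a(a+1)\cdots(a+k-1)$, $(a)_0=1$; $U_k$ is the Chebyshev polynomial of the second kind of degree $k$. The weight on $(-1,1)$ is, for $m\le n$, $$W(x)_{n,m}=(1-x^2)^{\frac12}\,\frac{2\ell+1}{n+1}\,\frac{(2\ell-m)!\,m!}{(2\ell)!}\sum_{t=0}^m(-1)^{m-t}\frac{(n-2\ell)_{m-t}}{(n+2)_{m-t}}\frac{(2\ell+2-t)_t}{t!}\,U_{n+m-2t}(x),$$ and $W(x)_{n,m}=W(x)_{m,n}$ if $n<m$. Put $\langle P,Q\rangle=\int_{-1}^1P(x)W(x)Q(x)^*dx$ for matrix polynomials $P,Q$. $\{P_n\}$ are the unique monic matrix polynomials ($\deg P_n=n$) with $\langle P_n,P_m\rangle=0$ for $n\neq m$. Differential operators $D=\sum_i\partial^iF_i(x)$, $\partial=\frac{d}{dx}$, with matrix polynomial coefficients, $\deg F_i\le i$, act from the right: $PD=\sum_i\partial^i(P)(x)F_i(x)$. $D$ is symmetric with respect to $W$ if $\langle PD,Q\rangle=\langle P,QD\rangle$ for all matrix polynomials $P,Q$. $\mathcal D(W)$ is the algebra of such operators $D$ for which there are constant matrices $\Gamma_n(D)$ with $P_nD=\Gamma_n(D)P_n$ for all $n\ge0$. *)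

theory Defs
  imports
    "HOL-Analysis.Henstock_Kurzweil_Integration"
    "Jordan_Normal_Form.Schur_Decomposition"
begin

text \<open>
  Throughout, the natural number \<open>L\<close> stands for \<open>2\<ell>\<close>, so that the spins
  \<open>\<ell> \<in> (1/2)\<nat>\<close>, \<open>\<ell> > 0\<close> correspond to \<open>L > 0\<close>. Matrices have complex entries and
  size \<open>(2\<ell> + 1) \<times> (2\<ell> + 1)\<close>, with indices starting at \<open>0\<close>.
\<close>

abbreviation ell :: "nat \<Rightarrow> 'a::field" where
  "ell L \<equiv> of_nat L / 2"

definition msum :: "nat \<Rightarrow> ('i \<Rightarrow> 'a::comm_monoid_add mat) \<Rightarrow> 'i set \<Rightarrow> 'a mat" where
  "msum d f I = mat d d (\<lambda>(a, b). \<Sum>i\<in>I. f i $$ (a, b))"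

text \<open>
  The elementary matrix \<open>E\<^bsub>i,j\<^esub>\<close>. The indices are integers, so that \<open>j = -1\<close> is out of range
  (and yields the zero matrix), in contrast to truncated subtraction.
\<close>
definition elem_mat :: "nat \<Rightarrow> int \<Rightarrow> int \<Rightarrow> 'a::zero_neq_one mat" where
  "elem_mat d i j = mat d d (\<lambda>(a, b). if int a = i \<and> int b = j then 1 else 0)"


subsection \<open>Matrix polynomials, given as matrices of polynomials\<close>

definition mp_eval :: "complex poly mat \<Rightarrow> real \<Rightarrow> complex mat" where
  "mp_eval P x = map_mat (\<lambda>p. poly p (complex_of_real x)) P"

definition mp_coeff :: "complex poly mat \<Rightarrow> nat \<Rightarrow> complex mat" where
  "mp_coeff P k = map_mat (\<lambda>p. coeff p k) P"

definition mp_const :: "complex mat \<Rightarrow> complex poly mat" where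
  "mp_const A = map_mat (\<lambda>c. [:c:]) A"

definition mp_degree_le :: "complex poly mat \<Rightarrow> nat \<Rightarrow> bool" where
  "mp_degree_le P n \<longleftrightarrow> (\<forall>i<dim_row P. \<forall>j<dim_col P. degree (P $$ (i, j)) \<le> n)"

definition monic_mp :: "nat \<Rightarrow> nat \<Rightarrow> complex poly mat \<Rightarrow> bool" where
  "monic_mp d n P \<longleftrightarrow>
     P \<in> carrier_mat d d \<and> mp_degree_le P n \<and> mp_coeff P n = 1\<^sub>m d"

definition mp_inner ::
  "nat \<Rightarrow> (real \<Rightarrow> complex mat) \<Rightarrow> complex poly mat \<Rightarrow> complex poly mat \<Rightarrow> complex mat" where
  "mp_inner d W P Q = mat d d (\<lambda>ij.
     integral {-1..1} (\<lambda>x. (mp_eval P x * W x * mat_adjoint (mp_eval Q x)) $$ ij))"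

definition monic_orthogonal ::
  "nat \<Rightarrow> (real \<Rightarrow> complex mat) \<Rightarrow> (nat \<Rightarrow> complex poly mat) \<Rightarrow> bool" where
  "monic_orthogonal d W P \<longleftrightarrow>
     (\<forall>n. monic_mp d n (P n)) \<and>
     (\<forall>n m. n \<noteq> m \<longrightarrow> mp_inner d W (P n) (P m) = 0\<^sub>m d d)"


subsection \<open>Differential operators acting from the right\<close>

text \<open>
  The list \<open>[F\<^sub>0, \<dots>, F\<^sub>r]\<close> stands for the operator \<open>\<Sum>i\<le>r. \<partial>\<^sup>i F\<^sub>i(x)\<close>.
\<close>
type_synonym diffop = "complex poly mat list"

definition is_diffop :: "nat \<Rightarrow> diffop \<Rightarrow> bool" where
  "is_diffop d D \<longleftrightarrow>
     (\<forall>i<length D. D ! i \<in> carrier_mat d d \<and> mp_degree_le (D ! i) i)"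

definition act_right :: "nat \<Rightarrow> complex poly mat \<Rightarrow> diffop \<Rightarrow> complex poly mat" where
  "act_right d P D = msum d (\<lambda>i. map_mat (pderiv ^^ i) P * D ! i) {..<length D}"

definition symmetric_diffop :: "nat \<Rightarrow> (real \<Rightarrow> complex mat) \<Rightarrow> diffop \<Rightarrow> bool" where
  "symmetric_diffop d W D \<longleftrightarrow>
     (\<forall>P \<in> carrier_mat d d. \<forall>Q \<in> carrier_mat d d.
        mp_inner d W (act_right d P D) Q = mp_inner d W P (act_right d Q D))"

text \<open>
  The algebra \<open>\<D>(W)\<close>. For a weight as below the sequence \<open>P\<close> of monic orthogonal polynomials
  is unique.
\<close>
definition diffop_algebra :: "nat \<Rightarrow> (real \<Rightarrow> complex mat) \<Rightarrow> diffop set" where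
  "diffop_algebra d W = {D. is_diffop d D \<and>
     (\<forall>P. monic_orthogonal d W P \<longrightarrow>
        (\<exists>\<Gamma>. \<forall>n. \<Gamma> n \<in> carrier_mat d d \<and> act_right d (P n) D = mp_const (\<Gamma> n) * P n))}"


subsection \<open>The weight\<close>

text \<open>Chebyshev polynomials of the second kind.\<close>
fun cheb_U :: "nat \<Rightarrow> real \<Rightarrow> real" where
  "cheb_U 0 x = 1"
| "cheb_U (Suc 0) x = 2 * x"
| "cheb_U (Suc (Suc k)) x = 2 * x * cheb_U (Suc k) x - cheb_U k x"

text \<open>
  The formula for \<open>W(x)\<^bsub>n,m\<^esub>\<close> with \<open>m \<le> n \<le> 2\<ell>\<close>; in this range no subtraction of naturals
  truncates.
\<close>
definition weight_entry :: "nat \<Rightarrow> real \<Rightarrow> nat \<Rightarrow> nat \<Rightarrow> real" where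
  "weight_entry L x n m =
     sqrt (1 - x^2) * ((2 * ell L + 1) / (real n + 1)) * (fact (L - m) * fact m / fact L) *
     (\<Sum>t=0..m. (-1) ^ (m - t)
        * (pochhammer (real n - 2 * ell L) (m - t) / pochhammer (real n + 2) (m - t))
        * (pochhammer (2 * ell L + 2 - real t) t / fact t)
        * cheb_U (n + m - 2 * t) x)"

definition weight :: "nat \<Rightarrow> real \<Rightarrow> complex mat" where
  "weight L x = mat (L + 1) (L + 1) (\<lambda>(n, m).
     complex_of_real (if m \<le> n then weight_entry L x n m else weight_entry L x m n))"


subsection \<open>The first order operator\<close>

definition A1 :: "nat \<Rightarrow> complex poly mat" where
  "A1 L =
     msum (L + 1) (\<lambda>i. [:(2 * ell L - of_nat i) / (2 * ell L):]
        \<cdot>\<^sub>m elem_mat (L + 1) (int i) (int i + 1)) {0..L}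
   - msum (L + 1) (\<lambda>i. ([:0, 1:] * [:(ell L - of_nat i) / ell L:])
        \<cdot>\<^sub>m elem_mat (L + 1) (int i) (int i)) {0..L}
   - msum (L + 1) (\<lambda>i. [:of_nat i / (2 * ell L):]
        \<cdot>\<^sub>m elem_mat (L + 1) (int i) (int i - 1)) {0..L}"

definition A0 :: "nat \<Rightarrow> complex mat" where
  "A0 L = msum (L + 1) (\<lambda>i. ((2 * ell L + 2) * (of_nat i - 2 * ell L) / (2 * ell L))
     \<cdot>\<^sub>m elem_mat (L + 1) (int i) (int i)) {0..L}"

definition op_E :: "nat \<Rightarrow> diffop" where
  "op_E L = [mp_const (A0 L), A1 L]"

definition Lambda_E :: "nat \<Rightarrow> nat \<Rightarrow> complex mat" where
  "Lambda_E L n = msum (L + 1) (\<lambda>i.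
     (- (of_nat n * (ell L - of_nat i) / ell L)
        + (2 * ell L + 2) * (of_nat i - 2 * ell L) / (2 * ell L))
     \<cdot>\<^sub>m elem_mat (L + 1) (int i) (int i)) {0..L}"

end

theory Submission
  imports Defs "HOL-Analysis.Equivalence_Lebesgue_Henstock_Integration"
begin

text \<open>
  Write \<open>x = cos \<theta>\<close>, \<open>z = exp (\<i> \<theta>)\<close> and \<open>N = L + 1\<close>. Because \<open>sin \<theta>\<close> times the Chebyshev polynomial of
  degree \<open>k\<close> is \<open>sin ((k + 1) \<theta>)\<close>, the hypergeometric coefficients of the weight collapse to
  products of two binomial coefficients, and \<open>(L choose n) (L choose m) W(x)\<^bsub>n,m\<^esub>\<close> becomes the
  coefficient of \<open>s\<^sup>n t\<^sup>m\<close> in the Bezoutian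
  \<open>(p(s) q(t) - q(s) p(t)) / (2 \<i> (s - t))\<close> of \<open>p(s) = (1 + z s)\<^sup>N\<close> and
  \<open>q(s) = (1 + cnj z s)\<^sup>N\<close> (\<open>weight_entry_cos\<close>). Both halves of the theorem are read off from this.
  
  Symmetry. Integration by parts reduces it to three properties of the matrix \<open>A\<^sub>1 W\<close>: it is
  antisymmetric, it vanishes at \<open>\<plusminus>1\<close>, and its derivative is \<open>A\<^sub>0 W - W A\<^sub>0\<close>. After scaling by
  binomial coefficients, the entries of \<open>A\<^sub>1 W\<close> are, up to one boundary term, multiples of sums of
  \<open>(L + 2 choose a) (L + 2 choose b) sin ((a - b) \<theta>)\<close> (\<open>bezoutian_flux_closed_form\<close>). Differentiating in
  \<open>\<theta>\<close> gives cosines with an extra factor \<open>a - b\<close>, and by Pascal-type relations this is a multiple of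
  \<open>sin \<theta>\<close> times the Bezoutian (\<open>bezoutian_cos_form\<close>). Antisymmetry comes for free: \<open>A\<^sub>1 W\<close> plus
  its transpose has derivative zero, since \<open>W\<close> is symmetric, and it vanishes at \<open>\<theta> = 0\<close>.
  
  Eigenvalues. The operator does not raise degrees, and on leading coefficients it acts on row \<open>a\<close>
  of a monic polynomial of degree \<open>n\<close> by the \<open>a\<close>-th diagonal entry of \<open>\<Lambda>\<^sub>n(E)\<close>. Hence the rows
  of \<open>R = P\<^sub>n E - \<Lambda>\<^sub>n(E) P\<^sub>n\<close> have degree less than \<open>n\<close>. By symmetry
  they are orthogonal to everything of degree less than \<open>n\<close>, in particular to themselves.
  That \<open>R = 0\<close> then needs the weight to be definite. This is Hermite's
  criterion for polynomials with all roots in one half-plane, and here it is explicit: factoring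
  \<open>X\<^sup>N - Y\<^sup>N\<close> with \<open>X = (1 + z s) (1 + cnj z t)\<close> and \<open>Y = (1 + cnj z s) (1 + z t)\<close> writes the Bezoutian as
  \<open>sin \<theta>\<close> times the Gram matrix of the coefficient vectors of \<open>(1 + z s)\<^sup>j (1 + cnj z s)\<^bsup>L - j\<^esup>\<close>
  (\<open>bezoutian_twin_gram\<close>), and these polynomials span all
  polynomials of degree at most \<open>L\<close> when \<open>z\<close> is not real (\<open>twin_total\<close>).
\<close>

section \<open>The weight as a Bezoutian\<close>

text \<open>
  For \<open>r = n + 1\<close> this is the coefficient of \<open>s\<^sup>n t\<^sup>m\<close> in the Bezoutian described above. The first
  index is shifted by one so that \<open>n = -1\<close>, which occurs when the subdiagonal of the operator
  meets row \<open>0\<close>, is covered without a case distinction; that row is zero by \<open>bezoutian_0\<close>.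
\<close>
definition bezoutian :: "nat \<Rightarrow> nat \<Rightarrow> nat \<Rightarrow> real \<Rightarrow> real" where
  "bezoutian L r m \<theta> = (\<Sum>b\<le>m. real ((L + 1) choose (r + m - b)) * real ((L + 1) choose b)
     * sin ((real r + real m - 2 * real b) * \<theta>))"

lemma sum_antisymmetric_interval:
  fixes f :: "nat \<Rightarrow> real"
  assumes "\<And>b. b \<in> {k..l} \<Longrightarrow> f (k + l - b) = - f b"
  shows "sum f {k..l} = 0"
proof -
  have "sum f {k..l} = (\<Sum>b\<in>{k..l}. f (k + l - b))"
    using sum.atLeastAtMost_rev[of f k l] by (simp add: add.commute)
  also have "\<dots> = - sum f {k..l}"
    using assms by (simp add: sum_negf)
  finally show ?thesis by simp
qed

lemma bezoutian_0: "bezoutian L 0 m \<theta> = 0"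
  unfolding bezoutian_def atMost_atLeast0
proof (rule sum_antisymmetric_interval, goal_cases)
  case (1 b)
  then have "(real 0 + real m - 2 * real (0 + m - b)) * \<theta>
    = - ((real 0 + real m - 2 * real b) * \<theta>)"
    by (simp add: of_nat_diff algebra_simps)
  then show ?case using 1 by (simp only: sin_minus) (simp add: mult.commute)
qed

text \<open>
  The two sums differ by the terms with \<open>m < b \<le> n\<close>, and these cancel in pairs: exchanging \<open>b\<close> with
  the complementary index \<open>n + m + 1 - b\<close> keeps the binomial coefficients and flips the sine.
\<close>
lemma bezoutian_sym_aux:
  assumes "m \<le> n"
  shows "bezoutian L (Suc n) m \<theta> = bezoutian L (Suc m) n \<theta>"
proof -
  define f where "f b = real ((L + 1) choose (n + m + 1 - b)) * real ((L + 1) choose b)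
     * sin ((real n + real m + 1 - 2 * real b) * \<theta>)" for b
  have "sum f {Suc m..n} = 0"
  proof (rule sum_antisymmetric_interval, goal_cases)
    case (1 b)
    then have "(real n + real m + 1 - 2 * real (Suc m + n - b)) * \<theta>
        = - ((real n + real m + 1 - 2 * real b) * \<theta>)"
      by (simp add: of_nat_diff algebra_simps)
    then have "sin ((real n + real m + 1 - 2 * real (Suc m + n - b)) * \<theta>)
        = - sin ((real n + real m + 1 - 2 * real b) * \<theta>)"
      by (simp only: sin_minus)
    moreover have "n + m + 1 - (Suc m + n - b) = b" "Suc m + n - b = n + m + 1 - b"
      using 1 by auto
    ultimately show ?case by (simp add: f_def)
  qed
  moreover have "{..n} = {..m} \<union> {Suc m..n}" using assms by auto
  ultimately have "sum f {..n} = sum f {..m}"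
    by (simp add: sum.union_disjoint)
  then show ?thesis by (simp add: bezoutian_def f_def algebra_simps)
qed

lemma bezoutian_sym: "bezoutian L (Suc n) m \<theta> = bezoutian L (Suc m) n \<theta>"
  using bezoutian_sym_aux[of m n] bezoutian_sym_aux[of n m] by (cases "m \<le> n") auto

lemma sin_mult_cheb_U: "sin \<theta> * cheb_U k (cos \<theta>) = sin (real (k + 1) * \<theta>)"
proof (induction k rule: induct_nat_012)
  case (ge2 k)
  have "2 * cos \<theta> * sin (real (k + 2) * \<theta>)
    = sin (real (k + 3) * \<theta>) + sin (real (k + 1) * \<theta>)"
    using sin_add[of "real (k + 2) * \<theta>" \<theta>] sin_diff[of "real (k + 2) * \<theta>" \<theta>]
    by (simp add: algebra_simps)
  moreover have "sin \<theta> * cheb_U (Suc (Suc k)) (cos \<theta>)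
      = 2 * cos \<theta> * (sin \<theta> * cheb_U (Suc k) (cos \<theta>))
        - sin \<theta> * cheb_U k (cos \<theta>)"
    by (simp add: algebra_simps)
  ultimately show ?case unfolding ge2 by (simp add: add.commute)
qed (simp_all add: sin_double)

lemma pochhammer_nat_plus_2: "pochhammer (real n + 2) k = fact (n + k + 1) / fact (n + 1)"
proof (induction k)
  case (Suc k)
  then show ?case by (simp add: pochhammer_Suc field_simps)
qed simp

text \<open>
  Both sides are \<open>(L + 1)! / (L - n - k)!\<close> if \<open>n + k \<le> L\<close>, and \<open>0\<close> otherwise.
\<close>
lemma choose_shift:
  assumes "n \<le> L"
  shows "real (L + 1) * fact n * fact k * real ((L - n) choose k) * real (L choose n)
    = fact (n + k + 1) * real ((L + 1) choose (n + k + 1))"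
proof (cases "k \<le> L - n")
  case True
  have "L - n - k = L - (n + k)" by simp
  then show ?thesis using True assms by (simp add: binomial_fact del: binomial_Suc_Suc)
next
  case False
  then have "L - n < k" "L + 1 < n + k + 1" using assms by auto
  then show ?thesis by (simp add: binomial_eq_0 del: binomial_Suc_Suc)
qed

text \<open>
  With \<open>k = m - t\<close>, the three factors depending on \<open>t\<close> are, up to factorials, \<open>(L - n choose k)\<close>,
  \<open>1 / (n + k + 1)!\<close> and \<open>(L + 1 choose t)\<close>.
\<close>
lemma weight_coefficient:
  assumes "t \<le> m" "m \<le> n" "n \<le> L"
  shows "((2 * ell L + 1) / (real n + 1)) * (fact (L - m) * fact m / fact L) *
     ((-1) ^ (m - t)
        * (pochhammer (real n - 2 * ell L) (m - t) / pochhammer (real n + 2) (m - t))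
        * (pochhammer (2 * ell L + 2 - real t) t / fact t))
     = real ((L + 1) choose (n + 1 + m - t)) * real ((L
       + 1) choose t) / (real (L choose n) * real (L choose m))"
proof -
  define k where "k = m - t"
  have 1: "pochhammer (2 * ell L + 2 - real t) t / fact t = real ((L + 1) choose t)"
    using gbinomial_pochhammer'[of "real (L + 1)" t]
    by (simp add: binomial_gbinomial algebra_simps del: binomial_Suc_Suc)
  have 2: "(-1) ^ k * pochhammer (real n - 2 * ell L) k = fact k * real ((L - n) choose k)"
    using gbinomial_pochhammer[of "real (L - n)" k] assms
    by (simp add: binomial_gbinomial of_nat_diff)
  have 3: "fact (L - m) * fact m / fact L = 1 / real (L choose m)"
    using assms by (simp add: binomial_fact)
  have 4: "n + 1 + m - t = n + k + 1" using assms by (simp add: k_def)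
  have pos: "real (L choose n) > 0" "real (L choose m) > 0"
    using assms by (simp_all add: zero_less_binomial)
  have f: "fact (n + 1) = (real n + 1) * (fact n :: real)" by simp
  have 5: "(real L + 1) / (real n + 1) * (fact k * real ((L - n) choose k) * fact (n + 1) / fact (n + k + 1))
     = real ((L + 1) choose (n + k + 1)) / real (L choose n)"
    using choose_shift[OF assms(3), of k] pos unfolding f
    by (simp add: divide_simps del: binomial_Suc_Suc fact_Suc) (simp add: algebra_simps del: binomial_Suc_Suc fact_Suc)
  have "((2 * ell L + 1) / (real n + 1)) * (fact (L - m) * fact m / fact L) *
     ((-1) ^ k * (pochhammer (real n - 2 * ell L) k / pochhammer (real n + 2) k)
        * (pochhammer (2 * ell L + 2 - real t) t / fact t))
     = ((real L + 1) / (real n + 1)) * (1 / real (L choose m)) * 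
     (((-1) ^ k * pochhammer (real n - 2 * ell L) k) / pochhammer (real n + 2) k * real ((L + 1) choose t))"
    unfolding 1 3 by simp
  also have "\<dots> = ((real L + 1) / (real n + 1) * (fact k * real ((L - n) choose k) * fact (n
    + 1) / fact (n + k + 1)))
      * real ((L + 1) choose t) / real (L choose m)"
    unfolding 2 pochhammer_nat_plus_2 by (simp add: mult_ac del: fact_Suc binomial_Suc_Suc)
  finally show ?thesis unfolding 5 4 k_def[symmetric] by simp
qed

lemma weight_entry_cos:
  assumes "m \<le> n" "n \<le> L" "0 \<le> \<theta>" "\<theta> \<le> pi"
  shows "weight_entry L (cos \<theta>) n m = bezoutian L (Suc n) m \<theta> / (real (L choose n)
    * real (L choose m))"
proof -
  have s: "sqrt (1 - (cos \<theta>)\<^sup>2) = sin \<theta>"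
    using assms sin_ge_zero[of \<theta>] by (simp add: sin_squared_eq[symmetric])
  let ?C = "real (L choose n) * real (L choose m)"
  define A where "A = ((2 * ell L + 1) / (real n + 1)) * (fact (L - m) * fact m / fact L)"
  define c where "c t = (-1) ^ (m - t)
        * (pochhammer (real n - 2 * ell L) (m - t) / pochhammer (real n + 2) (m - t))
        * (pochhammer (2 * ell L + 2 - real t) t / fact t)" for t
  have "weight_entry L (cos \<theta>) n m = sin \<theta> * A * (\<Sum>t=0..m. c t * cheb_U (n
    + m - 2 * t) (cos \<theta>))"
    unfolding weight_entry_def s A_def c_def by simp
  also have "\<dots> = (\<Sum>t\<le>m. A * c t * (sin \<theta> * cheb_U (n + m - 2 * t) (cos \<theta>)))"
    by (simp add: sum_distrib_left atMost_atLeast0 mult_ac)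
  also have "\<dots> = (\<Sum>t\<le>m. real ((L + 1) choose (Suc n + m - t)) * real ((L + 1) choose t)
     * sin ((real (Suc n) + real m - 2 * real t) * \<theta>) / ?C)"
  proof (rule sum.cong, simp, goal_cases)
    case (1 t)
    then have t: "t \<le> m" by simp
    have "A * c t = real ((L + 1) choose (n + 1 + m - t)) * real ((L + 1) choose t) / ?C"
      unfolding A_def c_def by (rule weight_coefficient[OF t assms(1,2)])
    moreover have "real (n + m - 2 * t + 1) = real (Suc n) + real m - 2 * real t"
      using t assms by (simp add: of_nat_diff)
    ultimately show ?case unfolding sin_mult_cheb_U by (simp add: algebra_simps del: binomial_Suc_Suc)
  qed
  finally show ?thesis by (simp add: bezoutian_def sum_divide_distrib)
qed

section \<open>The scaled entries of the first coefficient times the weight\<close>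

text \<open>
  These are the entries of \<open>A\<^sub>1 W\<close>, scaled by \<open>L (L choose n) (L choose m)\<close> (see \<open>flux_arccos\<close>): the scaling
  turns the coefficients \<open>L - n\<close> and \<open>n\<close> of the operator into \<open>n + 1\<close> and \<open>L + 1 - n\<close>.
\<close>
definition bezoutian_flux :: "nat \<Rightarrow> nat \<Rightarrow> nat \<Rightarrow> real \<Rightarrow> real" where
  "bezoutian_flux L n m \<theta> = (real n + 1) * bezoutian L (n + 2) m \<theta>
     - cos \<theta> * (real L - 2 * real n) * bezoutian L (n + 1) m \<theta> - (real L
       + 1 - real n) * bezoutian L n m \<theta>"

lemma choose_lower_top: "real (L + 1 choose c) = (real L + 2 - real c) * real (L + 2 choose c) / (real L + 2)"
proof -
  have "(L + 2 - c) * (L + 2 choose c) = (L + 2) * (L + 1 choose c)"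
    using binomial_absorb_comp[of "L + 2" c] by simp
  then have "real (L + 2 - c) * real (L + 2 choose c) = (real L + 2) * real (L + 1 choose c)"
    unfolding of_nat_mult[symmetric] of_nat_add[symmetric] of_nat_numeral[symmetric, of "Num.Bit0 Num.One", where 'a=real] by simp
  moreover have "real (L + 2 - c) * real (L + 2 choose c) = (real L + 2 - real c) * real (L + 2 choose c)"
    by (cases "c \<le> L + 2") (simp_all add: of_nat_diff binomial_eq_0 del: binomial_Suc_Suc add_2_eq_Suc')
  ultimately show ?thesis by (simp add: field_simps del: binomial_Suc_Suc add_2_eq_Suc')
qed

lemma choose_lower_both: "real (L + 1 choose c) = (real c + 1) * real (L + 2 choose Suc c) / (real L + 2)"
proof -
  have "Suc c * (Suc (L + 1) choose Suc c) = Suc (L + 1) * ((L + 1) choose c)"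
    by (rule Suc_times_binomial)
  then have "real (Suc c * (Suc (L + 1) choose Suc c)) = real (Suc (L + 1) * ((L + 1) choose c))"
    by (rule arg_cong)
  then have "real (Suc c) * real (L + 2 choose Suc c) = real (L + 2) * real (L + 1 choose c)"
    by (simp only: of_nat_mult add_2_eq_Suc' Suc_eq_plus1[symmetric])
  then have "(real c + 1) * real (L + 2 choose Suc c) = (real L + 2) * real (L + 1 choose c)"
    by (simp add: add.commute del: binomial_Suc_Suc add_2_eq_Suc')
  then show ?thesis by (simp add: field_simps del: binomial_Suc_Suc add_2_eq_Suc')
qed

text \<open>
  The reason for passing from \<open>L + 1\<close> to \<open>L + 2\<close>: all four products are multiples of
  the product on the right, and the bilinear part in \<open>b\<close> and \<open>c\<close> cancels, so that only a
  factor linear in \<open>b + c\<close> survives. In a sum with \<open>b + c\<close> constant that factor can be pulled out.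
\<close>
lemma choose_step_sin:
  "2 * (a + 1) * (real (L + 1 choose Suc c) * real (L + 1 choose Suc b))
   - (real L - 2 * a) * (real (L + 1 choose c) * real (L + 1 choose Suc b))
   - (real L - 2 * a) * (real (L + 1 choose Suc c) * real (L + 1 choose b))
   - 2 * (real L + 1 - a) * (real (L + 1 choose c) * real (L + 1 choose b))
   = (2 * a - real c - real b) * (real (L + 2 choose Suc c) * real (L + 2 choose Suc b))"
  unfolding choose_lower_top[of L "Suc c"] choose_lower_top[of L "Suc b"] choose_lower_both[of L c] choose_lower_both[of L b]
  by (simp add: divide_simps del: binomial_Suc_Suc add_2_eq_Suc') (simp add: algebra_simps del: binomial_Suc_Suc add_2_eq_Suc')

text \<open>
  The companion for the derivative: here the surviving factor is \<open>c - b\<close>, the frequency that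
  differentiating \<open>sin ((c - b) \<theta>)\<close> produces.
\<close>
lemma choose_step_cos:
  "(real L + 2) * (real (L + 1 choose c) * real (L + 1 choose Suc b) - real (L + 1 choose Suc c) * real (L
    + 1 choose b))
   = (real c - real b) * (real (L + 2 choose Suc c) * real (L + 2 choose Suc b))"
  unfolding choose_lower_top[of L "Suc c"] choose_lower_top[of L "Suc b"] choose_lower_both[of L c] choose_lower_both[of L b]
  by (simp add: divide_simps del: binomial_Suc_Suc add_2_eq_Suc') (simp add: algebra_simps del: binomial_Suc_Suc add_2_eq_Suc')

text \<open>
  Summation by parts with an arbitrary sequence \<open>s\<close> in place of the sines, so that the identity is one
  between coefficients. The left-hand side is the flux after the product formula has been applied to
  \<open>cos \<theta>\<close> times a sine; regrouping it by \<open>s b\<close> leaves one boundary term at \<open>Suc k\<close>.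
\<close>
lemma partial_sum_sin:
  fixes L :: nat and s :: "nat \<Rightarrow> real"
  assumes "k + 2 \<le> e"
  defines "N \<equiv> \<lambda>c. real (L + 1 choose c)" and "M \<equiv> \<lambda>c. real (L + 2 choose c)"
  shows "(\<Sum>b\<le>k. 2 * (a + 1) * (N (e - b) * N b) * s b
      - (real L - 2 * a) * (N (e - 1 - b) * N b) * (s b + s (Suc b))
      - 2 * (real L + 1 - a) * (N (e - 2 - b) * N b) * s (Suc b))
    = (2 * a + 2 - real e) * (\<Sum>b\<le>k. M (e - b) * M b * s b)
      - ((real L - 2 * a) * (N (e - 1 - k) * N k) + 2 * (real L + 1 - a) * (N (e - 2 - k) * N k)) * s (Suc k)"
  using assms(1)
proof (induction k)
  case 0
  then obtain c where e: "e = Suc c" by (cases e) auto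
  have "2 * (a + 1) * N (Suc c) - (real L - 2 * a) * N c = (2 * a + 1 - real c) * M (Suc c)"
    unfolding N_def M_def choose_lower_top[of L "Suc c"] choose_lower_both[of L c]
    by (simp add: divide_simps del: binomial_Suc_Suc add_2_eq_Suc') (simp add: algebra_simps del: binomial_Suc_Suc add_2_eq_Suc')
  then have "(2 * (a + 1) * N (Suc c) - (real L - 2 * a) * N c) * s 0
    = (2 * a + 1 - real c) * M (Suc c) * s 0"
    by simp
  moreover have "N 0 = 1" "M 0 = 1" by (simp_all add: N_def M_def)
  ultimately show ?case unfolding e by (simp add: algebra_simps)
next
  case (Suc k)
  define c where "c = e - Suc (Suc k)"
  have e: "e = Suc c + Suc k"
    using Suc.prems by (simp add: c_def)
  have i: "e - Suc k = Suc c" "e - 1 - Suc k = c" "e - 1 - k = Suc c" "e - 2 - k = c"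
    using e by auto
  have r: "2 * a + 2 - real e = 2 * a - real c - real k" using e by simp
  have st: "(2 * (a + 1) * (N (Suc c) * N (Suc k)) - (real L - 2 * a) * (N c * N (Suc k))
     - (real L - 2 * a) * (N (Suc c) * N k) - 2 * (real L + 1 - a) * (N c * N k)) * s (Suc k)
     = (2 * a - real c - real k) * (M (Suc c) * M (Suc k)) * s (Suc k)"
    unfolding N_def M_def choose_step_sin ..
  have IH: "(\<Sum>b\<le>k. 2 * (a + 1) * (N (e - b) * N b) * s b
      - (real L - 2 * a) * (N (e - 1 - b) * N b) * (s b + s (Suc b))
      - 2 * (real L + 1 - a) * (N (e - 2 - b) * N b) * s (Suc b))
    = (2 * a + 2 - real e) * (\<Sum>b\<le>k. M (e - b) * M b * s b)
      - ((real L - 2 * a) * (N (e - 1 - k) * N k) + 2 * (real L + 1 - a) * (N (e - 2 - k) * N k)) * s (Suc k)"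
    using Suc by simp
  show ?case
    unfolding sum.atMost_Suc IH using st unfolding i r by (simp add: algebra_simps)
qed

lemma partial_sum_cos:
  fixes L :: nat and s :: "nat \<Rightarrow> real"
  assumes "k + 1 \<le> e"
  defines "N \<equiv> \<lambda>c. real (L + 1 choose c)" and "M \<equiv> \<lambda>c. real (L + 2 choose c)"
  shows "(real L + 2) * (\<Sum>b\<le>k. N (e - 1 - b) * N b * (s b - s (Suc b)))
    = (\<Sum>b\<le>k. M (e - b) * M b * (real e - 2 * real b) * s b)
      - (real L + 2) * (N (e - 1 - k) * N k) * s (Suc k)"
  using assms(1)
proof (induction k)
  case 0
  then obtain c where e: "e = Suc c" by (cases e) auto
  have "(real L + 2) * N c = (real c + 1) * M (Suc c)"
    unfolding N_def M_def choose_lower_both[of L c] by simp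
  then have "(real L + 2) * N c * s 0 = (real c + 1) * M (Suc c) * s 0"
    by simp
  moreover have "N 0 = 1" "M 0 = 1" by (simp_all add: N_def M_def)
  ultimately show ?case unfolding e by (simp add: algebra_simps)
next
  case (Suc k)
  define c where "c = e - Suc (Suc k)"
  have e: "e = Suc c + Suc k"
    using Suc.prems by (simp add: c_def)
  have i: "e - Suc k = Suc c" "e - 1 - Suc k = c" "e - 1 - k = Suc c"
    using e by auto
  have r: "real e - 2 * real (Suc k) = real c - real k" using e by simp
  have st: "(real L + 2) * (N c * N (Suc k) - N (Suc c) * N k) * s (Suc k)
     = (real c - real k) * (M (Suc c) * M (Suc k)) * s (Suc k)"
    unfolding N_def M_def choose_step_cos ..
  have IH: "(real L + 2) * (\<Sum>b\<le>k. N (e - 1 - b) * N b * (s b - s (Suc b)))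
    = (\<Sum>b\<le>k. M (e - b) * M b * (real e - 2 * real b) * s b)
      - (real L + 2) * (N (e - 1 - k) * N k) * s (Suc k)"
    using Suc by simp
  show ?case
    unfolding sum.atMost_Suc distrib_left IH using st unfolding i r by (simp add: algebra_simps)
qed

lemma bezoutian_flux_closed_form:
  "2 * bezoutian_flux L n m \<theta> = (real n - real m) * (\<Sum>b\<le>m. real (L + 2 choose (n + m
    + 2 - b)) * real (L + 2 choose b)
      * sin ((real (n + m + 2) - 2 * real b) * \<theta>))
    - (real L + 2) * (real (L + 1 choose Suc n) * real (L + 1 choose m)) * sin ((real n - real m) * \<theta>)"
proof -
  define e where "e = n + m + 2"
  define N where "N c = real (L + 1 choose c)" for c
  define s where "s b = sin ((real e - 2 * real b) * \<theta>)" for b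
  have pr: "2 * cos \<theta> * sin ((real e - 1 - 2 * real b) * \<theta>) = s b + s (Suc b)" for b
    using sin_add[of "(real e - 1 - 2 * real b) * \<theta>" \<theta>] sin_diff[of "(real e - 1
      - 2 * real b) * \<theta>" \<theta>]
    by (simp add: s_def algebra_simps)
  have 1: "bezoutian L (n + 2) m \<theta> = (\<Sum>b\<le>m. N (e - b) * N b * s b)"
    unfolding bezoutian_def by (rule sum.cong) (simp_all add: e_def N_def s_def add_ac del: binomial_Suc_Suc)
  have 2: "2 * cos \<theta> * bezoutian L (n + 1) m \<theta>
    = (\<Sum>b\<le>m. N (e - 1 - b) * N b * (s b + s (Suc b)))"
    unfolding bezoutian_def sum_distrib_left
    by (rule sum.cong) (simp_all add: e_def N_def pr[symmetric, unfolded e_def] algebra_simps del: binomial_Suc_Suc)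
  have 3: "bezoutian L n m \<theta> = (\<Sum>b\<le>m. N (e - 2 - b) * N b * s (Suc b))"
    unfolding bezoutian_def by (rule sum.cong) (simp_all add: e_def N_def s_def algebra_simps del: binomial_Suc_Suc)
  have "2 * bezoutian_flux L n m \<theta> = 2 * (real n + 1) * bezoutian L (n + 2) m \<theta>
     - (real L - 2 * real n) * (2 * cos \<theta> * bezoutian L (n + 1) m \<theta>) - 2 * (real L
       + 1 - real n) * bezoutian L n m \<theta>"
    by (simp add: bezoutian_flux_def algebra_simps)
  also have "\<dots> = (\<Sum>b\<le>m. 2 * (real n + 1) * (N (e - b) * N b) * s b
      - (real L - 2 * real n) * (N (e - 1 - b) * N b) * (s b + s (Suc b))
      - 2 * (real L + 1 - real n) * (N (e - 2 - b) * N b) * s (Suc b))"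
    unfolding 1 2 3 by (simp add: sum_distrib_left sum_subtractf mult.assoc)
  also have "\<dots> = (2 * real n + 2 - real e) * (\<Sum>b\<le>m. real (L + 2 choose (e - b)) * real (L
    + 2 choose b) * s b)
      - ((real L - 2 * real n) * (N (e - 1 - m) * N m) + 2 * (real L
        + 1 - real n) * (N (e - 2 - m) * N m)) * s (Suc m)"
    unfolding N_def by (rule partial_sum_sin) (simp add: e_def)
  finally have eq: "2 * bezoutian_flux L n m \<theta>
    = (2 * real n + 2 - real e) * (\<Sum>b\<le>m. real (L + 2 choose (e - b)) * real (L + 2 choose b) * s b)
      - ((real L - 2 * real n) * (N (e - 1 - m) * N m) + 2 * (real L
        + 1 - real n) * (N (e - 2 - m) * N m)) * s (Suc m)" .
  have i: "e - 1 - m = Suc n" "e - 2 - m = n" "2 * real n + 2 - real e = real n - real m"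
    by (simp_all add: e_def)
  have s: "s (Suc m) = sin ((real n - real m) * \<theta>)" by (simp add: s_def e_def algebra_simps)
  have "(real L + 1 - real n) * N n = (real n + 1) * N (Suc n)"
    unfolding N_def choose_lower_top[of L "Suc n"] choose_lower_both[of L n]
    by (simp add: del: binomial_Suc_Suc add_2_eq_Suc')
  then have "(real L + 1 - real n) * N n * N m = (real n + 1) * N (Suc n) * N m"
    by simp
  then have "(real L - 2 * real n) * (N (Suc n) * N m) + 2 * (real L + 1 - real n) * (N n * N m)
      = (real L + 2) * (N (Suc n) * N m)"
    by (simp add: algebra_simps)
  then show ?thesis using eq unfolding i s by (simp add: e_def N_def s_def del: binomial_Suc_Suc add_2_eq_Suc')
qed

text \<open>
  The right-hand side is, up to the factor \<open>n - m\<close>, the derivative in \<open>\<theta>\<close> of the right-hand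
  side of \<open>bezoutian_flux_closed_form\<close>, frequency by frequency.
\<close>
lemma bezoutian_cos_form:
  "- 2 * (real L + 2) * sin \<theta> * bezoutian L (Suc n) m \<theta>
    = (\<Sum>b\<le>m. real (L + 2 choose (n + m + 2 - b)) * real (L + 2 choose b)
      * (real (n + m + 2) - 2 * real b) * cos ((real (n + m + 2) - 2 * real b) * \<theta>))
    - (real L + 2) * (real (L + 1 choose Suc n) * real (L + 1 choose m)) * cos ((real n - real m) * \<theta>)"
proof -
  define e where "e = n + m + 2"
  define N where "N c = real (L + 1 choose c)" for c
  define s where "s b = cos ((real e - 2 * real b) * \<theta>)" for b
  have pr: "- 2 * sin \<theta> * sin ((real e - 1 - 2 * real b) * \<theta>) = s b - s (Suc b)" for b
    using cos_add[of "(real e - 1 - 2 * real b) * \<theta>" \<theta>] cos_diff[of "(real e - 1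
      - 2 * real b) * \<theta>" \<theta>]
    by (simp add: s_def algebra_simps)
  have 2: "- 2 * sin \<theta> * bezoutian L (n + 1) m \<theta>
    = (\<Sum>b\<le>m. N (e - 1 - b) * N b * (s b - s (Suc b)))"
    unfolding bezoutian_def sum_distrib_left
    by (rule sum.cong) (simp_all add: e_def N_def pr[symmetric, unfolded e_def] algebra_simps del: binomial_Suc_Suc)
  have "- 2 * (real L + 2) * sin \<theta> * bezoutian L (Suc n) m \<theta>
    = (real L + 2) * (- 2 * sin \<theta> * bezoutian L (n + 1) m \<theta>)"
    by (simp add: algebra_simps)
  also have "\<dots> = (\<Sum>b\<le>m. real (L + 2 choose (e - b)) * real (L
    + 2 choose b) * (real e - 2 * real b) * s b)
      - (real L + 2) * (N (e - 1 - m) * N m) * s (Suc m)"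
    unfolding 2 unfolding N_def by (rule partial_sum_cos) (simp add: e_def)
  finally have eq: "- 2 * (real L + 2) * sin \<theta> * bezoutian L (Suc n) m \<theta>
     = (\<Sum>b\<le>m. real (L + 2 choose (e - b)) * real (L + 2 choose b) * (real e - 2 * real b) * s b)
      - (real L + 2) * (N (e - 1 - m) * N m) * s (Suc m)" .
  have i: "e - 1 - m = Suc n" by (simp add: e_def)
  have s: "s (Suc m) = cos ((real n - real m) * \<theta>)" by (simp add: s_def e_def algebra_simps)
  show ?thesis using eq unfolding i s by (simp add: e_def N_def s_def del: binomial_Suc_Suc add_2_eq_Suc')
qed

lemma bezoutian_flux_has_derivative:
  "(bezoutian_flux L n m has_real_derivative
     - (real L + 2) * (real n - real m) * sin \<theta> * bezoutian L (Suc n) m \<theta>) (at \<theta>)"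
proof -
  let ?M = "\<lambda>b. real (L + 2 choose (n + m + 2 - b)) * real (L + 2 choose b)"
  let ?j = "\<lambda>b. real (n + m + 2) - 2 * real b"
  let ?k = "(real L + 2) * (real (L + 1 choose Suc n) * real (L + 1 choose m))"
  have eq: "bezoutian_flux L n m = (\<lambda>\<theta>. ((real n
    - real m) * (\<Sum>b\<le>m. ?M b * sin (?j b * \<theta>)) - ?k * sin ((real n - real m) * \<theta>)) / 2)"
    unfolding bezoutian_flux_closed_form[symmetric] by simp
  have S': "((\<lambda>\<theta>. sin (c * \<theta>)) has_real_derivative cos (c * \<theta>)
    * c) (at \<theta>)" for c :: real
    by (auto intro!: derivative_eq_intros)
  have S: "((\<lambda>\<theta>. \<Sum>b\<le>m. M b * sin (j b * \<theta>)) has_real_derivative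
      (\<Sum>b\<le>m. M b * (cos (j b * \<theta>) * j b))) (at \<theta>)" for M j :: "nat \<Rightarrow> real"
    by (intro DERIV_sum DERIV_cmult S')
  have "(bezoutian_flux L n m has_real_derivative
     ((real n - real m) * (\<Sum>b\<le>m. ?M b * (cos (?j b * \<theta>) * ?j b)) - ?k * (cos ((real n
       - real m) * \<theta>) * (real n - real m))) / 2) (at \<theta>)"
    unfolding eq by (intro DERIV_cdivide DERIV_diff DERIV_cmult S S')
  also have "((real n - real m) * (\<Sum>b\<le>m. ?M b * (cos (?j b * \<theta>) * ?j b))
    - ?k * (cos ((real n - real m) * \<theta>) * (real n - real m))) / 2
    = (real n - real m) / 2 * ((\<Sum>b\<le>m. ?M b * ?j b * cos (?j b * \<theta>)) - ?k * cos ((real n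
      - real m) * \<theta>))"
  proof -
    have "(\<Sum>b\<le>m. ?M b * (cos (?j b * \<theta>) * ?j b))
      = (\<Sum>b\<le>m. ?M b * ?j b * cos (?j b * \<theta>))"
      by (rule sum.cong) (simp_all only: mult_ac)
    moreover have "(d * S - k * (c * d)) / 2 = d / 2 * (S - k * c)" for d S k c :: real
      by (simp add: field_simps)
    ultimately show ?thesis by simp
  qed
  finally show ?thesis unfolding bezoutian_cos_form[symmetric]
    by (rule DERIV_cong) (simp add: field_simps)
qed

text \<open>
  By \<open>bezoutian_flux_has_derivative\<close> the derivative of the flux is antisymmetric, because the
  Bezoutian is symmetric; and all sines vanish at \<open>\<theta> = 0\<close>.
\<close>
lemma bezoutian_flux_antisym: "bezoutian_flux L n m \<theta> = - bezoutian_flux L m n \<theta>"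
proof -
  let ?f = "\<lambda>\<theta>. bezoutian_flux L n m \<theta> + bezoutian_flux L m n \<theta>"
  have "(?f has_real_derivative 0) (at t)" for t
    using DERIV_add[OF bezoutian_flux_has_derivative[of L n m t] bezoutian_flux_has_derivative[of L m n t]]
    by (simp add: bezoutian_sym[of L n m] algebra_simps)
  then have "?f \<theta> = ?f 0" using DERIV_isconst_all[of ?f] by blast
  also have "\<dots> = 0" by (simp add: bezoutian_flux_def bezoutian_def)
  finally show ?thesis by simp
qed

section \<open>The flux of the operator\<close>

definition real_weight :: "nat \<Rightarrow> real \<Rightarrow> nat \<Rightarrow> nat \<Rightarrow> real" where
  "real_weight L x n m = (if m \<le> n then weight_entry L x n m else weight_entry L x m n)"

text \<open>
  The entries of the two coefficients of the operator, as real numbers. The diagonal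
  of the first one carries the only dependence on \<open>x\<close>.
\<close>
definition op_coeff1 :: "nat \<Rightarrow> real \<Rightarrow> nat \<Rightarrow> nat \<Rightarrow> real" where
  "op_coeff1 L x i k = (if k = Suc i then (real L - real i) / real L else 0)
     - (if k = i then x * ((real L - 2 * real i) / real L) else 0)
     - (if i = Suc k then real i / real L else 0)"

definition op_coeff0 :: "nat \<Rightarrow> nat \<Rightarrow> real" where
  "op_coeff0 L i = (real L + 2) * (real i - real L) / real L"

definition flux :: "nat \<Rightarrow> real \<Rightarrow> nat \<Rightarrow> nat \<Rightarrow> real" where
  "flux L x n m = (\<Sum>k\<le>L. op_coeff1 L x n k * real_weight L x k m)"

lemma op_coeff1_affine:
  "op_coeff1 L x i j = op_coeff1 L 0 i j + x * (op_coeff1 L 1 i j - op_coeff1 L 0 i j)"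
  by (simp add: op_coeff1_def algebra_simps)

lemma real_weight_sym: "real_weight L x n m = real_weight L x m n"
  by (auto simp: real_weight_def)

lemma real_weight_arccos:
  assumes "x \<in> {-1..1}" "n \<le> L" "m \<le> L"
  shows "real_weight L x n m = bezoutian L (Suc n) m (arccos x) / (real (L choose n) * real (L choose m))"
proof -
  have "weight_entry L x a b = bezoutian L (Suc a) b (arccos x) / (real (L choose a) * real (L choose b))"
    if "b \<le> a" "a \<le> L" for a b
    using weight_entry_cos[of b a L "arccos x"] that assms arccos_bounded[of x]
    by (simp add: cos_arccos)
  from this[of m n] this[of n m] show ?thesis
    using assms bezoutian_sym[of L n m] by (simp add: real_weight_def mult.commute)
qed

lemma bezoutian_eq_0: "L + 2 \<le> r \<Longrightarrow> bezoutian L r m \<theta> = 0"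
  unfolding bezoutian_def by (rule sum.neutral) (auto simp del: binomial_Suc_Suc simp: binomial_eq_0)

lemma flux_arccos:
  assumes "x \<in> {-1..1}" "n \<le> L" "m \<le> L" "0 < L"
  shows "flux L x n m = bezoutian_flux L n m (arccos x) / (real L * (real (L choose n) * real (L choose m)))"
proof -
  let ?\<theta> = "arccos x" and ?C = "real L * (real (L choose n) * real (L choose m))"
  have pos: "real (L choose m) > 0" "real (L choose n) > 0" "real L > 0"
    using assms by (simp_all add: zero_less_binomial)
  have absorb: "real (L choose Suc k) * (real k + 1) = (real L - real k) * real (L choose k)" if "k < L" for k
  proof -
    have "(L choose Suc k) * Suc k = (L - k) * (L choose k)"
      using binomial_absorb_comp[of L k] binomial_absorption[of k L] by (simp add: mult.commute)
    then have "real ((L choose Suc k) * Suc k) = real ((L - k) * (L choose k))"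
      by (rule arg_cong)
    then show ?thesis using that by (simp add: of_nat_diff algebra_simps)
  qed
  have 1: "(\<Sum>k\<le>L. (if k = Suc n then (real L - real n) / real L else 0) * real_weight L x k m)
      = (real n + 1) * bezoutian L (n + 2) m ?\<theta> / ?C"
  proof (cases "n = L")
    case True
    then show ?thesis by (simp add: bezoutian_eq_0 if_distrib[of "\<lambda>t. t * _"] cong: if_cong)
  next
    case False
    then have n: "n < L" using assms by simp
    have "(\<Sum>k\<le>L. (if k = Suc n then (real L - real n) / real L else 0) * real_weight L x k m)
       = (real L - real n) / real L * real_weight L x (Suc n) m"
      using n by (simp add: if_distrib[of "\<lambda>t. t * _"] cong: if_cong)
    also have "\<dots> = (real n + 1) * bezoutian L (n + 2) m ?\<theta> / ?C"
      using absorb[OF n] pos zero_less_binomial[of "Suc n" L] n assms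
      by (simp add: real_weight_arccos divide_simps) (simp add: mult_ac)
    finally show ?thesis .
  qed
  have 2: "(\<Sum>k\<le>L. (if k = n then x * ((real L - 2 * real n) / real L) else 0) * real_weight L x k m)
      = x * (real L - 2 * real n) * bezoutian L (n + 1) m ?\<theta> / ?C"
  proof -
    have "(\<Sum>k\<le>L. (if k = n then x * ((real L - 2 * real n) / real L) else 0) * real_weight L x k m)
        = x * ((real L - 2 * real n) / real L) * real_weight L x n m"
      using assms by (simp add: if_distrib[of "\<lambda>t. t * _"] cong: if_cong)
    then show ?thesis using assms by (simp add: real_weight_arccos)
  qed
  have 3: "(\<Sum>k\<le>L. (if n = Suc k then real n / real L else 0) * real_weight L x k m)
      = (real L + 1 - real n) * bezoutian L n m ?\<theta> / ?C"
  proof (cases n)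
    case 0
    then show ?thesis by (simp add: bezoutian_0)
  next
    case (Suc k)
    then have k: "k < L" using assms by simp
    have "(\<Sum>j\<le>L. (if n = Suc j then real n / real L else 0) * real_weight L x j m)
      = real n / real L * real_weight L x k m"
      using Suc k by (simp add: if_distrib[of "\<lambda>t. t * _"] cong: if_cong)
    also have "\<dots> = (real L + 1 - real n) * bezoutian L n m ?\<theta> / ?C"
      using absorb[OF k] pos zero_less_binomial[of k L] k assms unfolding Suc
      by (simp add: real_weight_arccos divide_simps) (simp add: algebra_simps)
    finally show ?thesis .
  qed
  have "flux L x n m = (real n + 1) * bezoutian L (n + 2) m ?\<theta> / ?C
     - x * (real L - 2 * real n) * bezoutian L (n + 1) m ?\<theta> / ?C - (real L
       + 1 - real n) * bezoutian L n m ?\<theta> / ?C"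
    unfolding flux_def op_coeff1_def left_diff_distrib sum_subtractf 1 2 3 ..
  then show ?thesis using assms
    by (simp add: bezoutian_flux_def cos_arccos diff_divide_distrib)
qed

lemma flux_antisym:
  assumes "x \<in> {-1..1}" "n \<le> L" "m \<le> L" "0 < L"
  shows "flux L x n m = - flux L x m n"
  using assms bezoutian_flux_antisym[of L n m] by (simp add: flux_arccos mult_ac)

lemma flux_boundary: "x\<^sup>2 = 1 \<Longrightarrow> flux L x n m = 0"
  by (simp add: flux_def real_weight_def weight_entry_def)

text \<open>
  The chain rule for \<open>\<theta> = arccos x\<close> contributes \<open>-1 / sin \<theta>\<close>, which cancels the factor \<open>sin \<theta>\<close> in
  \<open>bezoutian_flux_has_derivative\<close>; the remaining constant \<open>(L + 2) (n - m) / L\<close> is the difference of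
  two diagonal entries of \<open>A\<^sub>0\<close>.
\<close>
lemma flux_has_derivative:
  assumes "x \<in> {-1<..<1}" "n \<le> L" "m \<le> L" "0 < L"
  shows "((\<lambda>x. flux L x n m) has_real_derivative
     (op_coeff0 L n - op_coeff0 L m) * real_weight L x n m) (at x)"
proof -
  let ?C = "real L * (real (L choose n) * real (L choose m))"
  have x: "-1 < x" "x < 1" using assms by auto
  have s: "sin (arccos x) = sqrt (1 - x\<^sup>2)" using x by (simp add: sin_arccos)
  have s0: "sqrt (1 - x\<^sup>2) \<noteq> 0" using x by (metis less_numeral_extra(3) s sin_arccos_nonzero)
  have ac: "(arccos has_real_derivative inverse (- sqrt (1 - x\<^sup>2))) (at x)"
    by (rule DERIV_arccos[OF x])
  have "((\<lambda>x. bezoutian_flux L n m (arccos x) / ?C) has_real_derivative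
     (- (real L + 2) * (real n - real m) * sin (arccos x) * bezoutian L (Suc n) m (arccos x)
      * inverse (- sqrt (1 - x\<^sup>2))) / ?C) (at x)"
    by (rule DERIV_cdivide[OF DERIV_chain2[OF bezoutian_flux_has_derivative ac]])
  also have "(- (real L + 2) * (real n - real m) * sin (arccos x) * bezoutian L (Suc n) m (arccos x)
      * inverse (- sqrt (1 - x\<^sup>2))) / ?C = (op_coeff0 L n - op_coeff0 L m) * real_weight L x n m"
    using s0 assms unfolding s
    by (simp add: real_weight_arccos op_coeff0_def divide_simps zero_less_binomial) (simp add: algebra_simps)
  finally show ?thesis
    by (rule has_field_derivative_transform_within_open[where S = "{-1<..<1}"])
      (use assms in \<open>auto simp: flux_arccos\<close>)
qed

lemma continuous_on_cheb_U [continuous_intros]: "continuous_on A (cheb_U k)"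
proof (induction k rule: induct_nat_012)
  case 0
  have "cheb_U 0 = (\<lambda>x. 1)" by auto
  then show ?case by simp
next
  case 1
  have "cheb_U (Suc 0) = (\<lambda>x. 2 * x)" by auto
  then show ?case by (simp add: continuous_intros)
next
  case (ge2 n)
  have "cheb_U (Suc (Suc n)) = (\<lambda>x. 2 * x * cheb_U (Suc n) x - cheb_U n x)" by auto
  then show ?case using ge2 by (simp add: continuous_intros)
qed

lemma continuous_on_real_weight [continuous_intros]: "continuous_on A (\<lambda>x. real_weight L x n m)"
  unfolding real_weight_def weight_entry_def by (cases "m \<le> n") (auto intro!: continuous_intros simp: pochhammer_nat_plus_2)

lemma continuous_on_flux [continuous_intros]: "continuous_on A (\<lambda>x. flux L x n m)"
proof -
  have "continuous_on A (\<lambda>x. op_coeff1 L x i k)" for i k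
    by (subst op_coeff1_affine) (intro continuous_intros)
  then show ?thesis unfolding flux_def by (auto intro!: continuous_intros)
qed

section \<open>Symmetry on row vectors\<close>

text \<open>
  An entry of the matrix inner product, and an entry of the image under the operator, involve only
  one row of each matrix argument. Everything analytic is therefore done for row vectors of
  polynomials, represented as functions on indices of which only those up to \<open>L\<close> matter.
\<close>
definition row_form :: "nat \<Rightarrow> (nat \<Rightarrow> complex poly) \<Rightarrow> (nat \<Rightarrow> complex poly) \<Rightarrow> real \<Rightarrow> complex" where
  "row_form L p q x = (\<Sum>i\<le>L. \<Sum>j\<le>L. poly (p i) (of_real x) * of_real (real_weight L x i j)
    * cnj (poly (q j) (of_real x)))"

definition row_inner :: "nat \<Rightarrow> (nat \<Rightarrow> complex poly) \<Rightarrow> (nat \<Rightarrow> complex poly) \<Rightarrow> complex" where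
  "row_inner L p q = integral {-1..1} (row_form L p q)"

text \<open>
  The coefficient \<open>op_coeff1\<close> is affine in \<open>x\<close> (\<open>op_coeff1_affine\<close>), so its values at \<open>0\<close> and \<open>1\<close>
  determine it as a polynomial.
\<close>
definition row_op :: "nat \<Rightarrow> (nat \<Rightarrow> complex poly) \<Rightarrow> nat \<Rightarrow> complex poly" where
  "row_op L p j = (\<Sum>i\<le>L. pderiv (p i) * [: of_real (op_coeff1 L 0 i j), of_real (op_coeff1 L 1 i j
    - op_coeff1 L 0 i j) :])
     + smult (of_real (op_coeff0 L j)) (p j)"

lemma poly_row_op:
  "poly (row_op L p j) (of_real x)
    = (\<Sum>i\<le>L. poly (pderiv (p i)) (of_real x) * of_real (op_coeff1 L x i j))
      + of_real (op_coeff0 L j) * poly (p j) (of_real x)"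
proof -
  have "complex_of_real (op_coeff1 L x i j) = of_real (op_coeff1 L 0 i j)
      + of_real x * of_real (op_coeff1 L 1 i j - op_coeff1 L 0 i j)" for i
    by (subst op_coeff1_affine) (simp only: of_real_add of_real_mult)
  then show ?thesis by (simp only: row_op_def poly_sum poly_add poly_mult poly_smult poly_pCons poly_0 mult_zero_right add_0_right)
qed

lemma sum_contract_left:
  fixes P Q :: "nat \<Rightarrow> complex"
  shows "(\<Sum>i\<le>L. \<Sum>j\<le>L. (\<Sum>k\<le>L. P k * A k i) * w i j * Q j)
    = (\<Sum>k\<le>L. \<Sum>j\<le>L. P k * (\<Sum>i\<le>L. A k i * w i j) * Q j)"
proof -
  have "(\<Sum>i\<le>L. \<Sum>j\<le>L. (\<Sum>k\<le>L. P k * A k i) * w i j * Q j)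
      = (\<Sum>i\<le>L. \<Sum>j\<le>L. \<Sum>k\<le>L. P k * A k i * w i j * Q j)"
    by (simp add: sum_distrib_right)
  also have "\<dots> = (\<Sum>i\<le>L. \<Sum>k\<le>L. \<Sum>j\<le>L. P k * A k i * w i j * Q j)"
    by (intro sum.cong refl sum.swap)
  also have "\<dots> = (\<Sum>k\<le>L. \<Sum>i\<le>L. \<Sum>j\<le>L. P k * A k i * w i j * Q j)"
    by (rule sum.swap)
  also have "\<dots> = (\<Sum>k\<le>L. \<Sum>j\<le>L. \<Sum>i\<le>L. P k * A k i * w i j * Q j)"
    by (intro sum.cong refl sum.swap)
  finally show ?thesis by (simp add: sum_distrib_left sum_distrib_right mult.assoc)
qed

lemma sum_contract_right:
  fixes P Q :: "nat \<Rightarrow> complex"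
  shows "(\<Sum>i\<le>L. \<Sum>j\<le>L. P i * w i j * (\<Sum>k\<le>L. Q k * A k j))
    = (\<Sum>i\<le>L. \<Sum>k\<le>L. P i * (\<Sum>j\<le>L. A k j * w i j) * Q k)"
proof -
  have "(\<Sum>i\<le>L. \<Sum>j\<le>L. P i * w i j * (\<Sum>k\<le>L. Q k * A k j))
    = (\<Sum>i\<le>L. \<Sum>j\<le>L. \<Sum>k\<le>L. P i * w i j * (Q k * A k j))"
    by (simp add: sum_distrib_left)
  also have "\<dots> = (\<Sum>i\<le>L. \<Sum>k\<le>L. \<Sum>j\<le>L. P i * w i j * (Q k * A k j))"
    by (intro sum.cong refl sum.swap)
  finally show ?thesis by (simp add: sum_distrib_left sum_distrib_right mult_ac)
qed

text \<open>
  Antisymmetry of the flux turns the term with the derivative of \<open>q\<close> into the one that the product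
  rule requires: the right-hand side is the derivative of \<open>P F Q\<close>, with \<open>F\<close> the flux.
\<close>
lemma row_form_op_diff:
  fixes p q :: "nat \<Rightarrow> complex poly"
  assumes "x \<in> {-1..1}" "0 < L"
  defines "P \<equiv> \<lambda>i. poly (p i) (complex_of_real x)"
    and "P' \<equiv> \<lambda>i. poly (pderiv (p i)) (complex_of_real x)"
    and "Q \<equiv> \<lambda>i. cnj (poly (q i) (complex_of_real x))"
      and "Q' \<equiv> \<lambda>i. cnj (poly (pderiv (q i)) (complex_of_real x))"
  shows "row_form L (row_op L p) q x - row_form L p (row_op L q) x
    = (\<Sum>i\<le>L. \<Sum>j\<le>L. P' i * of_real (flux L x i j) * Q j
       + P i * of_real ((op_coeff0 L i - op_coeff0 L j) * real_weight L x i j) * Q j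
       + P i * of_real (flux L x i j) * Q' j)"
proof -
  let ?A = "\<lambda>i j. complex_of_real (op_coeff1 L x i j)" and ?w
    = "\<lambda>i j. complex_of_real (real_weight L x i j)"
    and ?c = "\<lambda>i. complex_of_real (op_coeff0 L i)" and ?F
      = "\<lambda>i j. complex_of_real (flux L x i j)"
  have F: "(\<Sum>i\<le>L. ?A k i * ?w i j) = ?F k j" for k j
    by (simp add: flux_def)
  have F': "(\<Sum>j\<le>L. ?A k j * ?w i j) = - ?F i k" if "i \<le> L" "k \<le> L" for k i
    using that assms flux_antisym[of x i L k] by (simp add: flux_def real_weight_sym[of L x i])
  have 1: "row_form L (row_op L p) q x = (\<Sum>i\<le>L. \<Sum>j\<le>L. (\<Sum>k\<le>L. P' k * ?A k i)
    * ?w i j * Q j)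
      + (\<Sum>i\<le>L. \<Sum>j\<le>L. ?c i * P i * ?w i j * Q j)"
    unfolding row_form_def poly_row_op P_def P'_def Q_def
    by (simp add: distrib_right sum.distrib)
  have 2: "row_form L p (row_op L q) x = (\<Sum>i\<le>L. \<Sum>j\<le>L. P i * ?w i j * (\<Sum>k\<le>L. Q' k
    * ?A k j))
      + (\<Sum>i\<le>L. \<Sum>j\<le>L. P i * ?w i j * (?c j * Q j))"
    unfolding row_form_def poly_row_op P_def Q_def Q'_def
    by (simp add: distrib_left sum.distrib)
  have 3: "(\<Sum>i\<le>L. \<Sum>k\<le>L. P i * (\<Sum>j\<le>L. ?A k j * ?w i j) * Q' k)
    = (\<Sum>i\<le>L. \<Sum>k\<le>L. - (P i * ?F i k * Q' k))"
    by (intro sum.cong refl) (simp add: F')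
  show ?thesis
    unfolding 1 2 sum_contract_left sum_contract_right F 3
    by (simp add: sum.distrib sum_negf sum_subtractf algebra_simps)
qed

lemma continuous_on_row_form: "continuous_on A (row_form L p q)"
  unfolding row_form_def by (intro continuous_intros)

lemma row_inner_symmetric:
  assumes "0 < L"
  shows "row_inner L (row_op L p) q = row_inner L p (row_op L q)"
proof -
  \<comment> \<open>the primitive supplied by the product rule; the flux vanishes at both ends of the interval\<close>
  define G where "G x = (\<Sum>i\<le>L. \<Sum>j\<le>L. poly (p i) (of_real x) * of_real (flux L x i j)
    * cnj (poly (q j) (of_real x)))" for x
  have cont: "continuous_on {-1..1} G"
    unfolding G_def by (intro continuous_intros)
  have der: "(G has_vector_derivative (row_form L (row_op L p) q x - row_form L p (row_op L q) x)) (at x)"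
    if x: "x \<in> {-1<..<1}" for x
  proof -
    have pd: "((\<lambda>x. poly r (complex_of_real x)) has_vector_derivative poly (pderiv r) (of_real x)) (at x)" for r
      by (rule has_vector_derivative_real_field[OF poly_DERIV])
    have cd: "((\<lambda>x. cnj (poly r (complex_of_real x))) has_vector_derivative cnj (poly (pderiv r) (of_real x))) (at x)" for r
      by (rule bounded_linear.has_vector_derivative[OF bounded_linear_cnj pd])
    have fd: "((\<lambda>x. complex_of_real (flux L x i j)) has_vector_derivative
        of_real ((op_coeff0 L i - op_coeff0 L j) * real_weight L x i j)) (at x)" if "i \<le> L" "j \<le> L" for i j
      using flux_has_derivative[OF x that assms] has_vector_derivative_of_real by blast
    have "(G has_vector_derivative (\<Sum>i\<le>L. \<Sum>j\<le>L.
        (poly (p i) (of_real x) * of_real (flux L x i j)) * cnj (poly (pderiv (q j)) (of_real x))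
        + (poly (p i) (of_real x) * of_real ((op_coeff0 L i - op_coeff0 L j) * real_weight L x i j)
           + poly (pderiv (p i)) (of_real x) * of_real (flux L x i j))
             * cnj (poly (q j) (of_real x)))) (at x)"
      unfolding G_def
      by (intro has_vector_derivative_sum has_vector_derivative_mult pd cd fd) auto
    moreover have "x \<in> {-1..1}" using x by simp
    ultimately show ?thesis
      unfolding row_form_op_diff[OF \<open>x \<in> {-1..1}\<close> assms]
      by (simp add: algebra_simps)
  qed
  have "((\<lambda>x. row_form L (row_op L p) q x - row_form L p (row_op L q) x) has_integral (G 1
    - G (-1))) {-1..1}"
    by (rule fundamental_theorem_of_calculus_interior[OF _ cont der]) simp_all
  moreover have "G 1 = 0" "G (-1) = 0"
    by (simp_all add: G_def flux_boundary)
  moreover have "row_form L p q integrable_on {-1..1}" for p q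
    by (rule integrable_continuous_real[OF continuous_on_row_form])
  ultimately show ?thesis
    unfolding row_inner_def
    using integral_diff[of "row_form L (row_op L p) q" "{-1..1}" "row_form L p (row_op L q)"]
    by (simp add: integral_unique)
qed

section \<open>Definiteness of the weight\<close>

abbreviation twin :: "complex \<Rightarrow> nat \<Rightarrow> nat \<Rightarrow> complex poly" where
  "twin z j k \<equiv> [:1, z:] ^ j * [:1, cnj z:] ^ k"

definition twin_gram :: "complex \<Rightarrow> nat \<Rightarrow> nat \<Rightarrow> nat \<Rightarrow> complex" where
  "twin_gram z L n m = (\<Sum>j\<le>L. coeff (twin z j (L - j)) n * cnj (coeff (twin z j (L - j)) m))"

lemma coeff_linear_times: "coeff ([:1, a:] * p) (Suc n) = coeff p (Suc n) + a * coeff p n"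
  "coeff ([:1, a:] * p) 0 = coeff p 0" for a :: complex
  by (simp_all add: coeff_pCons)

lemma coeff_one_plus_power: "coeff ([:1, a:] ^ N) n = of_nat (N choose n) * a ^ n" for a :: complex
proof (cases "n \<le> N")
  case True
  then show ?thesis by (simp add: coeff_linear_poly_power)
next
  case False
  have "degree ([:1, a:] ^ N) \<le> N"
    by (rule order_trans[OF degree_power_le]) simp
  then show ?thesis using False by (simp add: coeff_eq_0 binomial_eq_0)
qed

text \<open>
  In the product of \<open>(1 + z s) (1 + cnj z t) - (1 + cnj z s) (1 + z t)\<close> with the
  generating function of \<open>twin_gram\<close>, consecutive summands cancel, since
  one factor \<open>1 + z s\<close> or \<open>1 + cnj z s\<close> shifts the index \<open>j\<close>. What remains is
  \<open>(1 + z s)\<^sup>N (1 + cnj z t)\<^sup>N - (1 + cnj z s)\<^sup>N (1 + z t)\<^sup>N\<close>, given here by its coefficients.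
\<close>
lemma twin_gram_telescope:
  fixes z :: complex and L :: nat
  defines "N \<equiv> L + 1"
  defines "F \<equiv> \<lambda>n m j. coeff (twin z j (N - j)) n * cnj (coeff (twin z j (N - j)) m)"
  shows "(\<Sum>j\<le>L. F n m (Suc j) - F n m j) = of_nat (N choose n) * of_nat (N choose m) * (z ^ n
    * cnj z ^ m - cnj z ^ n * z ^ m)"
proof -
  have "(\<Sum>j\<le>L. F n m (Suc j) - F n m j) = F n m N - F n m 0"
    using sum_lessThan_telescope[of "F n m" N] by (simp add: N_def lessThan_Suc_atMost)
  then show ?thesis by (simp add: F_def coeff_one_plus_power algebra_simps)
qed

text \<open>
  The prefactor in the telescoping sum is \<open>(z - cnj z) (s - t)\<close>, and multiplication by \<open>s - t\<close>
  becomes a difference of neighbouring coefficients.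
\<close>
lemma twin_gram_rec:
  fixes z :: complex and L :: nat
  defines "N \<equiv> L + 1"
  shows "(z - cnj z) * (twin_gram z L n (Suc m) - twin_gram z L (Suc n) m)
      = of_nat (N choose Suc n) * of_nat (N choose Suc m) * (z ^ Suc n * cnj z ^ Suc m
        - cnj z ^ Suc n * z ^ Suc m)"
    and "(z - cnj z) * twin_gram z L n 0 = of_nat (N choose Suc n) * (z ^ Suc n - cnj z ^ Suc n)"
proof -
  \<comment> \<open>multiplying the \<open>j\<close>-th product by either linear factor gives the products for \<open>N\<close> with index \<open>j + 1\<close> or \<open>j\<close>\<close>
  have up: "twin z (Suc j) (N - Suc j) = [:1, z:] * twin z j (L - j)" for j
    by (simp only: N_def Suc_eq_plus1[symmetric] diff_Suc_Suc power_Suc mult.assoc)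
  have down: "twin z j (N - j) = [:1, cnj z:] * twin z j (L - j)" if "j \<le> L" for j
    using that by (simp only: N_def Suc_eq_plus1[symmetric] Suc_diff_le power_Suc mult_ac)
  note c = coeff_linear_times
  have "(z - cnj z) * (twin_gram z L n (Suc m) - twin_gram z L (Suc n) m)
     = (\<Sum>j\<le>L. coeff (twin z (Suc j) (N - Suc j)) (Suc n) * cnj (coeff (twin z (Suc j) (N
       - Suc j)) (Suc m))
         - coeff (twin z j (N - j)) (Suc n) * cnj (coeff (twin z j (N - j)) (Suc m)))"
    unfolding twin_gram_def sum_distrib_left sum_subtractf[symmetric]
    by (rule sum.cong) (simp_all only: up down c atMost_iff, simp add: algebra_simps)
  then show "(z - cnj z) * (twin_gram z L n (Suc m) - twin_gram z L (Suc n) m)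
      = of_nat (N choose Suc n) * of_nat (N choose Suc m) * (z ^ Suc n * cnj z ^ Suc m
        - cnj z ^ Suc n * z ^ Suc m)"
    unfolding N_def twin_gram_telescope .
  have "(z - cnj z) * twin_gram z L n 0
     = (\<Sum>j\<le>L. coeff (twin z (Suc j) (N - Suc j)) (Suc n) * cnj (coeff (twin z (Suc j) (N - Suc j)) 0)
         - coeff (twin z j (N - j)) (Suc n) * cnj (coeff (twin z j (N - j)) 0))"
    unfolding twin_gram_def sum_distrib_left sum_subtractf[symmetric]
    by (rule sum.cong) (simp_all only: up down c atMost_iff, simp add: algebra_simps)
  then show "(z - cnj z) * twin_gram z L n 0 = of_nat (N choose Suc n) * (z ^ Suc n - cnj z ^ Suc n)"
    unfolding N_def twin_gram_telescope by simp
qed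

lemma cis_powers_sin: "cis \<theta> ^ n * cnj (cis \<theta>) ^ m - cnj (cis \<theta>) ^ n * cis \<theta> ^ m
   = 2 * \<i> * of_real (sin ((real n - real m) * \<theta>))"
proof -
  have "cis \<theta> ^ n * cnj (cis \<theta>) ^ m = cis ((real n - real m) * \<theta>)" for n m
    unfolding cis_cnj DeMoivre cis_mult by (simp add: algebra_simps)
  from this[of n m] this[of m n] have "cis \<theta> ^ n * cnj (cis \<theta>) ^ m
    = cis ((real n - real m) * \<theta>)"
    "cnj (cis \<theta>) ^ n * cis \<theta> ^ m = cis (- ((real n - real m) * \<theta>))"
    by (simp_all only: mult.commute[of "cnj (cis \<theta>) ^ n"] minus_diff_eq mult_minus_left[symmetric])
  then show ?thesis by (simp add: complex_eq_iff)
qed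

text \<open>
  Both sides satisfy the same recursion along antidiagonals: for the Gram matrix it is
  \<open>twin_gram_rec\<close>, and for the Bezoutian passing from \<open>m\<close> to \<open>m + 1\<close> with \<open>n + m\<close> fixed
  adds the last summand of its defining sum.
\<close>
lemma bezoutian_twin_gram: "complex_of_real (bezoutian L (Suc n) m \<theta>)
  = of_real (sin \<theta>) * twin_gram (cis \<theta>) L n m"
proof (induction m arbitrary: n)
  case 0
  have d: "cis \<theta> - cnj (cis \<theta>) = 2 * \<i> * of_real (sin \<theta>)"
    by (simp add: complex_eq_iff)
  have "2 * \<i> * of_real (bezoutian L (Suc n) 0 \<theta>)
     = of_nat (L + 1 choose Suc n) * (2 * \<i> * of_real (sin ((real (Suc n) - real 0) * \<theta>)))"
    by (simp add: bezoutian_def del: binomial_Suc_Suc)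
  also have "\<dots> = 2 * \<i> * of_real (sin \<theta>) * twin_gram (cis \<theta>) L n 0"
    unfolding cis_powers_sin[symmetric] d[symmetric] twin_gram_rec(2) by simp
  finally show ?case by simp
next
  case (Suc m)
  have d: "cis \<theta> - cnj (cis \<theta>) = 2 * \<i> * of_real (sin \<theta>)"
    by (simp add: complex_eq_iff)
  have "bezoutian L (Suc n) (Suc m) \<theta> = bezoutian L (Suc (Suc n)) m \<theta>
     + real (L + 1 choose Suc n) * real (L + 1 choose Suc m) * sin ((real (Suc n) - real (Suc m)) * \<theta>)"
    unfolding bezoutian_def sum.atMost_Suc by (simp add: algebra_simps del: binomial_Suc_Suc)
  then have "2 * \<i> * of_real (bezoutian L (Suc n) (Suc m) \<theta>)
     = 2 * \<i> * of_real (bezoutian L (Suc (Suc n)) m \<theta>)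
     + of_nat (L + 1 choose Suc n) * of_nat (L + 1 choose Suc m) * (2 * \<i> * of_real (sin ((real (Suc n)
       - real (Suc m)) * \<theta>)))"
    by (simp add: algebra_simps del: binomial_Suc_Suc of_nat_Suc)
  also have "\<dots> = 2 * \<i> * of_real (sin \<theta>) * twin_gram (cis \<theta>) L n (Suc m)"
    unfolding cis_powers_sin[symmetric] Suc.IH twin_gram_rec(1)[symmetric] d by (simp add: algebra_simps)
  finally show ?case by simp
qed

text \<open>
  A linear functional on polynomials of degree at most \<open>L\<close> that annihilates all these products is
  zero. Since \<open>1\<close> and \<open>s\<close> are combinations of \<open>1 + z s\<close> and \<open>1 + cnj z s\<close>, a cofactor \<open>h\<close> of degree
  \<open>k + 1\<close> can be traded for cofactors of degree \<open>k\<close> and one more linear factor.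
\<close>
lemma twin_total:
  fixes y :: "nat \<Rightarrow> complex"
  assumes z: "z \<noteq> cnj z"
    and ann: "\<And>j. j \<le> L \<Longrightarrow> (\<Sum>n\<le>L. y n * coeff (twin z j (L - j)) n) = 0"
    and n: "n \<le> L"
  shows "y n = 0"
proof -
  define \<phi> where "\<phi> p = (\<Sum>n\<le>L. y n * coeff p n)" for p
  have add: "\<phi> (p + q) = \<phi> p + \<phi> q" for p q
    by (simp add: \<phi>_def algebra_simps sum.distrib)
  have smult: "\<phi> (smult c p) = c * \<phi> p" for c p
    by (simp add: \<phi>_def sum_distrib_left mult_ac)
  \<comment> \<open>\<open>1\<close> is \<open>a\<close> times \<open>z (1 + cnj z s) - cnj z (1 + z s)\<close>, and \<open>s\<close> is \<open>a\<close> times \<open>(1 + z s) - (1 + cnj z s)\<close>\<close>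
  define a where "a = 1 / (z - cnj z)"
  have a: "a * z - a * cnj z = 1" using z by (simp add: a_def divide_simps)
  have "\<phi> (h * twin z i j) = 0" if "degree h \<le> k" "i + j + k = L" for h i j k
    using that
  proof (induction k arbitrary: h i j)
    case 0
    then obtain c where "h = [:c:]" by (metis degree_eq_zeroE le_zero_eq)
    moreover have "\<phi> (twin z i j) = 0" using ann[of i] 0 by (auto simp: \<phi>_def)
    ultimately show ?case by (simp add: smult)
  next
    case (Suc k)
    obtain c h' where h: "h = pCons c h'" by (cases h)
    have deg: "degree h' \<le> k" using Suc.prems h by (auto split: if_splits)
    define h1 where "h1 = smult a (h' - [:c * cnj z:])"
    define h2 where "h2 = smult a ([:c * z:] - h')"
    have "h = h1 * [:1, z:] + h2 * [:1, cnj z:]"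
    proof (rule poly_eq_poly_eq_iff[THEN iffD1], rule ext)
      fix x
      have "poly (h1 * [:1, z:] + h2 * [:1, cnj z:]) x = (a * z - a * cnj z) * (c + x * poly h' x)"
        by (simp add: h1_def h2_def algebra_simps)
      then show "poly h x = poly (h1 * [:1, z:] + h2 * [:1, cnj z:]) x"
        by (simp add: a h)
    qed
    then have "h * twin z i j = h1 * twin z (Suc i) j + h2 * twin z i (Suc j)"
      by (simp add: algebra_simps)
    moreover have "degree h1 \<le> k" "degree h2 \<le> k"
      unfolding h1_def h2_def
      by (auto intro!: order_trans[OF degree_smult_le] degree_diff_le deg)
    moreover have "\<phi> (h1 * twin z (Suc i) j) = 0" "\<phi> (h2 * twin z i (Suc j)) = 0"
      using \<open>degree h1 \<le> k\<close> \<open>degree h2 \<le> k\<close> Suc.prems by (rule_tac Suc.IH; simp)+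
    ultimately show ?case by (simp only: add add_0)
  qed
  from this[of "monom 1 n" L 0 0] n have "\<phi> (monom 1 n) = 0"
    by (simp add: degree_monom_eq)
  then show ?thesis using n by (simp add: \<phi>_def if_distrib cong: if_cong)
qed

lemma row_form_self:
  assumes "x \<in> {-1..1}"
  shows "row_form L p p x = of_real (sqrt (1 - x\<^sup>2) * (\<Sum>j\<le>L.
     (cmod (\<Sum>n\<le>L. poly (p n) (of_real x) / of_nat (L choose n) * coeff (twin (cis (arccos x)) j (L
       - j)) n))\<^sup>2))"
proof -
  let ?u = "\<lambda>j n. coeff (twin (cis (arccos x)) j (L - j)) n"
  let ?y = "\<lambda>n. poly (p n) (of_real x) / of_nat (L choose n)"
  let ?s = "complex_of_real (sqrt (1 - x\<^sup>2))"
  have s: "sin (arccos x) = sqrt (1 - x\<^sup>2)"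
    using assms by (intro sin_arccos_abs) auto
  have w: "complex_of_real (real_weight L x n m) = ?s
    * twin_gram (cis (arccos x)) L n m / (of_nat (L choose n) * of_nat (L choose m))"
    if "n \<le> L" "m \<le> L" for n m
    using assms that by (simp add: real_weight_arccos bezoutian_twin_gram s)
  have "row_form L p p x = (\<Sum>n\<le>L. \<Sum>m\<le>L. ?s * (\<Sum>j\<le>L. (?y n * ?u j n) * cnj (?y m
    * ?u j m)))"
    unfolding row_form_def
    by (intro sum.cong refl) (simp add: w twin_gram_def sum_distrib_left sum_divide_distrib mult_ac)
  also have "\<dots> = ?s * (\<Sum>n\<le>L. \<Sum>m\<le>L. \<Sum>j\<le>L. (?y n * ?u j n) * cnj (?y m
    * ?u j m))"
    by (simp only: sum_distrib_left)
  also have "(\<Sum>n\<le>L. \<Sum>m\<le>L. \<Sum>j\<le>L. (?y n * ?u j n) * cnj (?y m * ?u j m))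
      = (\<Sum>n\<le>L. \<Sum>j\<le>L. \<Sum>m\<le>L. (?y n * ?u j n) * cnj (?y m * ?u j m))"
    by (intro sum.cong refl sum.swap)
  also have "\<dots> = (\<Sum>j\<le>L. \<Sum>n\<le>L. \<Sum>m\<le>L. (?y n * ?u j n) * cnj (?y m * ?u j m))"
    by (rule sum.swap)
  also have "\<dots> = (\<Sum>j\<le>L. (\<Sum>n\<le>L. ?y n * ?u j n) * cnj (\<Sum>m\<le>L. ?y m * ?u j m))"
    by (simp only: sum_product cnj_sum)
  also have "\<dots> = (\<Sum>j\<le>L. of_real ((cmod (\<Sum>n\<le>L. ?y n * ?u j n))\<^sup>2))"
    by (simp only: complex_norm_square)
  finally show ?thesis by simp
qed

text \<open>
  The integrand is continuous and nonnegative, so it vanishes identically; at each interior point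
  \<open>twin_total\<close> then kills the values of all \<open>p i\<close>, and a polynomial with infinitely many zeros is zero.
\<close>
lemma row_inner_definite:
  assumes "row_inner L p p = 0" "i \<le> L"
  shows "p i = 0"
proof -
  define g where "g x = Re (row_form L p p x)" for x
  have cont: "continuous_on {-1..1} g"
    unfolding g_def by (intro continuous_intros continuous_on_row_form)
  have pos: "g x \<ge> 0" if "x \<in> {-1..1}" for x
  proof -
    have "1 - x\<^sup>2 \<ge> 0" using that by (auto simp: abs_square_le_1)
    then show ?thesis unfolding g_def row_form_self[OF that] Re_complex_of_real
      by (intro mult_nonneg_nonneg sum_nonneg) simp_all
  qed
  have "(row_form L p p has_integral 0) {-1..1}"
    using assms(1) integrable_continuous_real[OF continuous_on_row_form]
    unfolding row_inner_def by (metis integrable_integral)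
  from has_integral_Re[OF this] have "(g has_integral 0) {-1..1}"
    by (simp add: g_def[abs_def])
  then have "integral {-1..1} g = 0" by (rule integral_unique)
  then have g0: "g x = 0" if "x \<in> {-1..1}" for x
    using integral_eq_0_iff[OF cont _ pos] that by auto
  have zero: "poly (p i) (of_real x) = 0" if x: "x \<in> {-1<..<1}" for x
  proof -
    let ?z = "cis (arccos x)"
    define y where "y n = poly (p n) (of_real x) / of_nat (L choose n)" for n
    have s: "sqrt (1 - x\<^sup>2) > 0" using x abs_square_less_1[of x] by (auto simp: abs_less_iff)
    have x': "x \<in> {-1..1}" using x by simp
    have "sqrt (1 - x\<^sup>2) * (\<Sum>j\<le>L. (cmod (\<Sum>n\<le>L. y n * coeff (twin ?z j (L
      - j)) n))\<^sup>2) = 0"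
      using g0[OF x'] unfolding g_def row_form_self[OF x'] y_def by simp
    then have "(\<Sum>j\<le>L. (cmod (\<Sum>n\<le>L. y n * coeff (twin ?z j (L - j)) n))\<^sup>2) = 0"
      using s by simp
    then have ann: "(\<Sum>n\<le>L. y n * coeff (twin ?z j (L - j)) n) = 0" if "j \<le> L" for j
      using that by (simp add: sum_nonneg_eq_0_iff)
    have "sin (arccos x) = sqrt (1 - x\<^sup>2)" using x by (simp add: sin_arccos)
    then have "?z \<noteq> cnj ?z" using s by (auto simp: complex_eq_iff)
    then have "y i = 0" by (rule twin_total[OF _ ann assms(2)])
    then show ?thesis using assms(2) by (simp add: y_def)
  qed
  show ?thesis
  proof (rule ccontr)
    assume "p i \<noteq> 0"
    then have "finite {w. poly (p i) w = 0}" by (rule poly_roots_finite)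
    moreover have "complex_of_real ` {-1<..<1} \<subseteq> {w. poly (p i) w = 0}" using zero by auto
    ultimately have "finite (complex_of_real ` {-1<..<1})" by (rule rev_finite_subset)
    then have "finite {-1<..<1::real}" by (rule finite_imageD) (simp add: inj_on_def)
    then show False by (simp add: infinite_Ioo)
  qed
qed

section \<open>Orthogonal rows are eigenvectors\<close>

lemma row_form_diff_right: "row_form L p (\<lambda>i. q i - r i) x = row_form L p q x - row_form L p r x"
  by (simp add: row_form_def right_diff_distrib sum_subtractf)

lemma row_form_sum_right:
  "row_form L p (\<lambda>i. \<Sum>b\<in>B. smult (c b) (r b i)) x
    = (\<Sum>b\<in>B. cnj (c b) * row_form L p (r b) x)"
proof -
  have "row_form L p (\<lambda>i. \<Sum>b\<in>B. smult (c b) (r b i)) x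
     = (\<Sum>i\<le>L. \<Sum>j\<le>L. \<Sum>b\<in>B. cnj (c b) * (poly (p i) (of_real x)
       * of_real (real_weight L x i j) * cnj (poly (r b j) (of_real x))))"
    by (simp add: row_form_def poly_sum sum_distrib_left mult_ac)
  also have "\<dots> = (\<Sum>i\<le>L. \<Sum>b\<in>B. \<Sum>j\<le>L. cnj (c b) * (poly (p i) (of_real x)
    * of_real (real_weight L x i j) * cnj (poly (r b j) (of_real x))))"
    by (intro sum.cong refl sum.swap)
  also have "\<dots> = (\<Sum>b\<in>B. \<Sum>i\<le>L. \<Sum>j\<le>L. cnj (c b) * (poly (p i) (of_real x)
    * of_real (real_weight L x i j) * cnj (poly (r b j) (of_real x))))"
    by (rule sum.swap)
  finally show ?thesis by (simp only: row_form_def sum_distrib_left)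
qed

lemma row_form_diff_smult_left:
  "row_form L (\<lambda>i. p i - smult c (r i)) q x = row_form L p q x - c * row_form L r q x"
  by (simp add: row_form_def algebra_simps sum_subtractf sum_distrib_left)

lemma integrable_row_form: "row_form L p q integrable_on {-1..1}"
  by (rule integrable_continuous_real[OF continuous_on_row_form])

lemma row_inner_diff_right: "row_inner L p (\<lambda>i. q i - r i) = row_inner L p q - row_inner L p r"
  unfolding row_inner_def row_form_diff_right[abs_def]
  by (rule integral_diff[OF integrable_row_form integrable_row_form])

lemma row_inner_sum_right:
  assumes "finite B"
  shows "row_inner L p (\<lambda>i. \<Sum>b\<in>B. smult (c b) (r b i))
    = (\<Sum>b\<in>B. cnj (c b) * row_inner L p (r b))"
  unfolding row_inner_def row_form_sum_right[abs_def]
  by (subst integral_sum[OF assms]) (auto intro!: integrable_on_mult_right integrable_row_form)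

lemma row_inner_diff_smult_left:
  "row_inner L (\<lambda>i. p i - smult c (r i)) q = row_inner L p q - c * row_inner L r q"
  unfolding row_inner_def row_form_diff_smult_left[abs_def]
  by (subst integral_diff) (auto intro!: integrable_on_mult_right integrable_row_form)

lemma coeff_row_op:
  "coeff (row_op L p j) k = (\<Sum>i\<le>L. of_real (op_coeff1 L 0 i j) * (of_nat (Suc k)
    * coeff (p i) (Suc k))
       + of_real (op_coeff1 L 1 i j - op_coeff1 L 0 i j) * (of_nat k * coeff (p i) k))
     + of_real (op_coeff0 L j) * coeff (p j) k"
proof -
  have "coeff (q * [:u, v:]) k = u * coeff q k + v * (case k of 0 \<Rightarrow> 0 | Suc k \<Rightarrow> coeff q k)" for q :: "complex poly" and u v
    by (simp add: coeff_pCons mult.commute[of q] split: nat.split)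
  then show ?thesis
    unfolding row_op_def coeff_add coeff_sum
    by (cases k) (simp_all add: coeff_pderiv)
qed

text \<open>
  A strict degree bound, phrased with coefficients so that the bound \<open>0\<close> means that the row vanishes.
\<close>
definition deg_below :: "nat \<Rightarrow> nat \<Rightarrow> (nat \<Rightarrow> complex poly) \<Rightarrow> bool" where
  "deg_below L d q \<longleftrightarrow> (\<forall>i\<le>L. \<forall>k\<ge>d. coeff (q i) k = 0)"

lemma deg_below_row_op: "deg_below L d p \<Longrightarrow> deg_below L d (row_op L p)"
  by (auto simp: deg_below_def coeff_row_op)

text \<open>
  The rows \<open>P n a\<close> of a sequence of monic orthogonal matrix polynomials.
\<close>
locale row_orthogonal =
  fixes L :: nat and P :: "nat \<Rightarrow> nat \<Rightarrow> nat \<Rightarrow> complex poly"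
  assumes L: "0 < L"
    and deg: "\<And>n a. a \<le> L \<Longrightarrow> deg_below L (Suc n) (P n a)"
    and lead: "\<And>n a i. a \<le> L \<Longrightarrow> i \<le> L \<Longrightarrow> coeff (P n a i) n
      = (if a = i then 1 else 0)"
    and orth: "\<And>n m a b. n \<noteq> m \<Longrightarrow> a \<le> L \<Longrightarrow> b \<le> L \<Longrightarrow> row_inner L (P n a) (P m b) = 0"
begin

text \<open>
  Monic rows of degree \<open>d\<close> allow the coefficients of degree \<open>d\<close> of \<open>q\<close> to be removed, one for each
  index, by a combination orthogonal to \<open>P n a\<close>.
\<close>
lemma orthogonal_to_lower_degree:
  assumes "deg_below L d q" "d \<le> n" "a \<le> L"
  shows "row_inner L (P n a) q = 0"
  using assms(1,2)
proof (induction d arbitrary: q)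
  case 0
  then have "q i = 0" if "i \<le> L" for i
    using that by (intro poly_eqI) (simp add: deg_below_def)
  then have "row_form L (P n a) q = (\<lambda>x. 0)"
    by (intro ext) (simp add: row_form_def)
  then show ?case by (simp add: row_inner_def)
next
  case (Suc d)
  \<comment> \<open>since the leading coefficient of \<open>P d\<close> is the identity matrix, this matches \<open>q\<close> in degree \<open>d\<close>\<close>
  define s where "s i = (\<Sum>b\<in>{..L}. smult (coeff (q b) d) (P d b i))" for i
  have "coeff (s i) k = (if k = d then coeff (q i) d else 0)" if "i \<le> L" "k \<ge> d" for i k
    using that deg[of _ d] lead[of _ i d]
    by (auto simp: s_def coeff_sum deg_below_def if_distrib[of "\<lambda>t. _ * t"] cong: if_cong)
  then have "deg_below L d (\<lambda>i. q i - s i)"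
    using Suc.prems by (auto simp: deg_below_def)
  then have "row_inner L (P n a) (\<lambda>i. q i - s i) = 0"
    using Suc by simp
  moreover have "row_inner L (P n a) s = 0"
    unfolding s_def using Suc.prems assms(3)
    by (subst row_inner_sum_right) (auto intro!: sum.neutral simp: orth)
  ultimately show ?case by (simp add: row_inner_diff_right)
qed

definition eigenvalue :: "nat \<Rightarrow> nat \<Rightarrow> real" where
  "eigenvalue n a = op_coeff0 L a - real n * ((real L - 2 * real a) / real L)"

text \<open>
  The defect \<open>R\<close> has degree below \<open>n\<close>, and by symmetry of the operator its inner product with itself
  only involves inner products of \<open>P n a\<close> with rows of degree below \<open>n\<close>.
\<close>
lemma row_op_eigen:
  assumes a: "a \<le> L" and j: "j \<le> L"
  shows "row_op L (P n a) j = smult (of_real (eigenvalue n a)) (P n a j)"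
proof -
  define R where "R = (\<lambda>j. row_op L (P n a) j - smult (of_real (eigenvalue n a)) (P n a j))"
  have low: "deg_below L n R"
    unfolding deg_below_def
  proof (intro allI impI)
    fix i k assume i: "i \<le> L" and k: "n \<le> k"
    have z: "coeff (P n a i') (Suc k) = 0" if "i' \<le> L" for i'
      using deg[OF a, of n] that k by (simp add: deg_below_def)
    show "coeff (R i) k = 0"
    proof (cases "k = n")
      case True
      have "coeff (row_op L (P n a) i) n
          = of_real (op_coeff1 L 1 a i - op_coeff1 L 0 a i) * of_nat n
            + of_real (op_coeff0 L i) * coeff (P n a i) n"
        unfolding coeff_row_op using z a True lead[OF a, of _ n]
        by (simp add: if_distrib[of "\<lambda>t. _ * t"] cong: if_cong)
      also have "\<dots> = of_real (eigenvalue n a) * coeff (P n a i) n"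
        using lead[OF a i, of n] by (auto simp: eigenvalue_def op_coeff1_def)
      finally show ?thesis using True by (simp add: R_def)
    next
      case False
      then have "coeff (P n a i') k = 0" if "i' \<le> L" for i'
        using deg[OF a, of n] that k by (simp add: deg_below_def)
      then show ?thesis using z i by (simp add: R_def coeff_row_op)
    qed
  qed
  have "row_inner L R R = row_inner L (P n a) (row_op L R) - of_real (eigenvalue n a) * row_inner L (P n a) R"
    unfolding row_inner_symmetric[OF L, symmetric]
    by (subst R_def) (rule row_inner_diff_smult_left)
  also have "\<dots> = 0"
    using orthogonal_to_lower_degree[OF low _ a] orthogonal_to_lower_degree[OF deg_below_row_op[OF low] _ a] by simp
  finally have "R j = 0" using row_inner_definite j by blast
  then show ?thesis by (simp add: R_def)
qed

end

section \<open>From rows to matrices\<close>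

definition row_of :: "complex poly mat \<Rightarrow> nat \<Rightarrow> nat \<Rightarrow> complex poly" where
  "row_of P a i = P $$ (a, i)"

lemma mat_adjoint_index:
  assumes "Q \<in> carrier_mat d d" "i < d" "j < d"
  shows "mat_adjoint Q $$ (i, j) = cnj (Q $$ (j, i))"
  using assms by (simp add: mat_adjoint_def mat_of_rows_index)

lemma mult_mat_index:
  assumes "A \<in> carrier_mat (L + 1) (L + 1)" "B \<in> carrier_mat (L + 1) (L + 1)" "i \<le> L" "j \<le> L"
  shows "(A * B) $$ (i, j) = (\<Sum>k\<le>L. A $$ (i, k) * B $$ (k, j))"
proof -
  have "(A * B) $$ (i, j) = (\<Sum>k\<in>{0..<L + 1}. A $$ (i, k) * B $$ (k, j))"
    using assms by (simp add: scalar_prod_def del: sum.op_ivl_Suc)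
  also have "{0..<L + 1} = {..L}" by auto
  finally show ?thesis .
qed

lemma mp_inner_index:
  assumes P: "P \<in> carrier_mat (L + 1) (L + 1)" and Q: "Q \<in> carrier_mat (L + 1) (L + 1)"
    and a: "a \<le> L" and b: "b \<le> L"
  shows "mp_inner (L + 1) (weight L) P Q $$ (a, b) = row_inner L (row_of P a) (row_of Q b)"
proof -
  have "(mp_eval P x * weight L x * mat_adjoint (mp_eval Q x)) $$ (a, b)
    = row_form L (row_of P a) (row_of Q b) x" for x
  proof -
    have 1: "mp_eval P x \<in> carrier_mat (L + 1) (L + 1)" "mp_eval Q x \<in> carrier_mat (L + 1) (L + 1)"
      "weight L x \<in> carrier_mat (L + 1) (L + 1)" "mat_adjoint (mp_eval Q x) \<in> carrier_mat (L
        + 1) (L + 1)"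
      using P Q by (auto simp: mp_eval_def weight_def mat_adjoint_def)
    have adj: "mat_adjoint (mp_eval Q x) $$ (j, b) = cnj (poly (row_of Q b j) (of_real x))" if "j \<le> L" for j
      using mat_adjoint_index[OF 1(2), of j b] that b Q by (simp add: mp_eval_def row_of_def)
    have "(mp_eval P x * weight L x * mat_adjoint (mp_eval Q x)) $$ (a, b)
       = (\<Sum>j\<le>L. (\<Sum>i\<le>L. mp_eval P x $$ (a, i) * weight L x $$ (i, j))
         * mat_adjoint (mp_eval Q x) $$ (j, b))"
      unfolding mult_mat_index[OF mult_carrier_mat[OF 1(1,3)] 1(4) a b]
      by (intro sum.cong refl) (simp only: mult_mat_index[OF 1(1,3) a] atMost_iff)
    also have "\<dots> = (\<Sum>j\<le>L. \<Sum>i\<le>L. poly (row_of P a i) (of_real x)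
      * of_real (real_weight L x i j) * cnj (poly (row_of Q b j) (of_real x)))"
      unfolding sum_distrib_right using a b P Q
      by (intro sum.cong refl) (simp add: adj, simp add: mp_eval_def row_of_def weight_def real_weight_def)
    also have "\<dots> = row_form L (row_of P a) (row_of Q b) x"
      unfolding row_form_def by (rule sum.swap)
    finally show ?thesis .
  qed
  then show ?thesis using a b by (simp add: mp_inner_def row_inner_def)
qed

lemma msum_carrier: "msum d f I \<in> carrier_mat d d"
  by (simp add: msum_def)

lemma msum_elem_index:
  fixes c :: "nat \<Rightarrow> 'a::comm_ring_1"
  assumes "a < d" "b < d"
  shows "msum d (\<lambda>t. c t \<cdot>\<^sub>m elem_mat d (int t) (g t)) {0..L} $$ (a, b)
    = (if a \<le> L \<and> int b = g a then c a else 0)"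
proof -
  have "msum d (\<lambda>t. c t \<cdot>\<^sub>m elem_mat d (int t) (g t)) {0..L} $$ (a, b)
    = (\<Sum>t\<in>{0..L}. (c t \<cdot>\<^sub>m elem_mat d (int t) (g t)) $$ (a, b))"
    using assms by (simp add: msum_def)
  also have "\<dots> = (\<Sum>t\<in>{0..L}. if t = a then (if int b = g a then c a else 0) else 0)"
    using assms by (intro sum.cong refl) (simp add: elem_mat_def)
  finally have "msum d (\<lambda>t. c t \<cdot>\<^sub>m elem_mat d (int t) (g t)) {0..L} $$ (a, b)
    = (\<Sum>t\<in>{0..L}. if t = a then (if int b = g a then c a else 0) else 0)" .
  then show ?thesis by simp
qed

lemma A0_index:
  assumes "a \<le> L" "b \<le> L" "0 < L"
  shows "A0 L $$ (a, b) = (if a = b then of_real (op_coeff0 L a) else 0)"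
  using assms by (simp add: A0_def msum_elem_index op_coeff0_def eq_commute)

lemma A1_index:
  assumes "a \<le> L" "b \<le> L" "0 < L"
  shows "A1 L $$ (a, b) = [: of_real (op_coeff1 L 0 a b), of_real (op_coeff1 L 1 a b - op_coeff1 L 0 a b) :]"
proof -
  have e: "int b = int a - 1 \<longleftrightarrow> a = Suc b" "int b = int a + 1 \<longleftrightarrow> b
    = Suc a" "int b = int a \<longleftrightarrow> b = a" by auto
  have m: "dim_row (msum d f I) = d" "dim_col (msum d f I)
    = d" for d I and f :: "nat \<Rightarrow> complex poly mat"
    by (simp_all add: msum_def)
  have ab: "a < L + 1" "b < L + 1" using assms by auto
  have eq: "A1 L $$ (a, b) = (if b = Suc a then [:(2 * ell L - of_nat a) / (2 * ell L):] else 0)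
     - (if b = a then [:0, 1:] * [:(ell L - of_nat a) / ell L:] else 0)
     - (if a = Suc b then [:of_nat a / (2 * ell L):] else 0)"
    unfolding A1_def
    by (simp only: index_minus_mat m msum_elem_index[OF ab] e ab assms(1) simp_thms)
  show ?thesis unfolding eq using assms(3)
    by (auto simp: op_coeff1_def diff_divide_distrib right_diff_distrib mult.commute)
qed

lemma A0_carrier: "A0 L \<in> carrier_mat (L + 1) (L + 1)"
  by (simp add: A0_def msum_def)

lemma A1_carrier: "A1 L \<in> carrier_mat (L + 1) (L + 1)"
  unfolding A1_def by (intro minus_carrier_mat msum_carrier)

lemma act_right_carrier: "act_right d P D \<in> carrier_mat d d"
  by (simp add: act_right_def msum_def)

lemma act_right_index:
  assumes P: "P \<in> carrier_mat (L + 1) (L + 1)" and a: "a \<le> L" and j: "j \<le> L" and "0 < L"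
  shows "act_right (L + 1) P (op_E L) $$ (a, j) = row_op L (row_of P a) j"
proof -
  have "act_right (L + 1) P (op_E L) $$ (a, j)
     = (map_mat id P * mp_const (A0 L)) $$ (a, j) + (map_mat pderiv P * A1 L) $$ (a, j)"
    using a j by (simp add: act_right_def msum_def op_E_def numeral_2_eq_2 lessThan_Suc id_def o_def)
  also have "(map_mat id P * mp_const (A0 L)) $$ (a, j) = (\<Sum>i\<le>L. P $$ (a, i) * [:A0 L $$ (i, j):])"
    using P a j A0_carrier[of L] by (subst mult_mat_index) (auto simp: mp_const_def)
  also have "\<dots> = (\<Sum>i\<le>L. if i = j then smult (of_real (op_coeff0 L j)) (P $$ (a, j)) else 0)"
    using j assms by (intro sum.cong refl) (auto simp: A0_index)
  also have "\<dots> = smult (of_real (op_coeff0 L j)) (row_of P a j)"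
    using j by (simp add: row_of_def)
  also have "(map_mat pderiv P * A1 L) $$ (a, j) = (\<Sum>i\<le>L. pderiv (P $$ (a, i)) * A1 L $$ (i, j))"
    using P a j A1_carrier[of L] by (subst mult_mat_index) auto
  also have "\<dots> = (\<Sum>i\<le>L. pderiv (row_of P a i)
    * [: of_real (op_coeff1 L 0 i j), of_real (op_coeff1 L 1 i j - op_coeff1 L 0 i j) :])"
    using j assms by (intro sum.cong) (auto simp: A1_index row_of_def)
  finally show ?thesis by (simp add: row_op_def add.commute)
qed

lemma row_of_act_right:
  assumes "P \<in> carrier_mat (L + 1) (L + 1)" "a \<le> L" "i \<le> L" "0 < L"
  shows "row_of (act_right (L + 1) P (op_E L)) a i = row_op L (row_of P a) i"
  using act_right_index[OF assms] by (simp add: row_of_def)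

lemma row_inner_cong:
  "(\<And>i. i \<le> L \<Longrightarrow> p i = p' i) \<Longrightarrow> (\<And>i. i \<le> L \<Longrightarrow> q i = q' i) \<Longrightarrow> row_inner L p q = row_inner L p' q'"
  by (simp add: row_inner_def row_form_def[abs_def])

lemma op_E_symmetric:
  assumes "0 < L"
  shows "symmetric_diffop (L + 1) (weight L) (op_E L)"
  unfolding symmetric_diffop_def
proof (intro ballI)
  fix P Q :: "complex poly mat"
  assume P: "P \<in> carrier_mat (L + 1) (L + 1)" and Q: "Q \<in> carrier_mat (L + 1) (L + 1)"
  show "mp_inner (L + 1) (weight L) (act_right (L + 1) P (op_E L)) Q
    = mp_inner (L + 1) (weight L) P (act_right (L + 1) Q (op_E L))"
    (is "?A = ?B")
  proof (rule eq_matI)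
    fix a b assume "a < dim_row ?B" "b < dim_col ?B"
    then have ab: "a \<le> L" "b \<le> L" by (simp_all add: mp_inner_def)
    have "?A $$ (a, b) = row_inner L (row_op L (row_of P a)) (row_of Q b)"
      unfolding mp_inner_index[OF act_right_carrier Q ab]
      by (rule row_inner_cong) (simp_all only: row_of_act_right[OF P ab(1) _ assms])
    also have "\<dots> = row_inner L (row_of P a) (row_op L (row_of Q b))"
      by (rule row_inner_symmetric[OF assms])
    also have "\<dots> = ?B $$ (a, b)"
      unfolding mp_inner_index[OF P act_right_carrier ab]
      by (rule row_inner_cong) (simp_all only: row_of_act_right[OF Q ab(2) _ assms])
    finally show "?A $$ (a, b) = ?B $$ (a, b)" .
  qed (simp_all add: mp_inner_def)
qed

lemma op_E_is_diffop: 
  assumes "0 < L"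
  shows "is_diffop (L + 1) (op_E L)"
proof -
  have "degree (A1 L $$ (i, j)) \<le> 1" if "i \<le> L" "j \<le> L" for i j
    using that assms by (simp add: A1_index)
  then have "mp_degree_le (A1 L) 1"
    using A1_carrier[of L] by (auto simp: mp_degree_le_def less_Suc_eq_le)
  moreover have "mp_degree_le (mp_const (A0 L)) 0" "mp_const (A0 L) \<in> carrier_mat (L + 1) (L + 1)"
    using A0_carrier[of L] by (auto simp: mp_degree_le_def mp_const_def)
  ultimately show ?thesis
    using A1_carrier[of L] by (auto simp: is_diffop_def op_E_def less_Suc_eq nth_Cons split: nat.split)
qed

lemma monic_orthogonal_rows:
  assumes "monic_orthogonal (L + 1) (weight L) P" "0 < L"
  shows "row_orthogonal L (\<lambda>n. row_of (P n))"
proof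
  have c: "P n \<in> carrier_mat (L + 1) (L + 1)" for n
    using assms by (simp add: monic_orthogonal_def monic_mp_def)
  show "deg_below L (Suc n) (row_of (P n) a)" if "a \<le> L" for n a
    unfolding deg_below_def
  proof (intro allI impI)
    fix i k assume ik: "i \<le> L" "Suc n \<le> k"
    have "degree (P n $$ (a, i)) \<le> n"
      using assms that ik(1) carrier_matD[OF c[of n]]
        unfolding monic_orthogonal_def monic_mp_def mp_degree_le_def
      by simp
    then show "coeff (row_of (P n) a i) k = 0"
      using ik by (intro coeff_eq_0) (simp add: row_of_def)
  qed
  show "coeff (row_of (P n) a i) n = (if a = i then 1 else 0)" if "a \<le> L" "i \<le> L" for n a i
  proof -
    have "mp_coeff (P n) n $$ (a, i) = (1\<^sub>m (L + 1) :: complex mat) $$ (a, i)"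
      using assms by (simp add: monic_orthogonal_def monic_mp_def)
    then show ?thesis using that c[of n] by (simp add: mp_coeff_def row_of_def)
  qed
  show "row_inner L (row_of (P n) a) (row_of (P m) b)
    = 0" if "n \<noteq> m" "a \<le> L" "b \<le> L" for n m a b
    using assms that mp_inner_index[OF c c that(2,3), of n m] by (simp add: monic_orthogonal_def)
qed (rule assms)

lemma Lambda_E_index:
  assumes "a \<le> L" "b \<le> L" "0 < L"
  shows "Lambda_E L n $$ (a, b) = (if a = b then of_real (op_coeff0 L a - real n * ((real L
    - 2 * real a) / real L)) else 0)"
  using assms by (auto simp: Lambda_E_def msum_elem_index op_coeff0_def field_simps)

lemma Lambda_E_carrier: "Lambda_E L n \<in> carrier_mat (L + 1) (L + 1)"
  by (simp add: Lambda_E_def msum_def)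

lemma op_E_eigen:
  assumes mo: "monic_orthogonal (L + 1) (weight L) P" and L: "0 < L"
  shows "act_right (L + 1) (P n) (op_E L) = mp_const (Lambda_E L n) * P n"
proof (rule eq_matI)
  interpret row_orthogonal L "\<lambda>n. row_of (P n)" by (rule monic_orthogonal_rows[OF assms])
  have c: "P n \<in> carrier_mat (L + 1) (L + 1)"
    using mo by (simp add: monic_orthogonal_def monic_mp_def)
  fix a j assume "a < dim_row (mp_const (Lambda_E L n) * P n)" "j < dim_col (mp_const (Lambda_E L n) * P n)"
  then have aj: "a \<le> L" "j \<le> L" using c Lambda_E_carrier[of L n] by (auto simp: mp_const_def)
  have "(mp_const (Lambda_E L n) * P n) $$ (a, j) = (\<Sum>i\<le>L. [:Lambda_E L n $$ (a, i):]
    * P n $$ (i, j))"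
    using c aj Lambda_E_carrier[of L n] by (subst mult_mat_index) (auto simp: mp_const_def)
  also have "\<dots> = (\<Sum>i\<le>L. if i = a then smult (of_real (eigenvalue n a)) (P n $$ (a, j)) else 0)"
    using aj L by (intro sum.cong refl) (auto simp: Lambda_E_index eigenvalue_def)
  also have "\<dots> = row_op L (row_of (P n) a) j"
    using aj by (simp add: row_op_eigen row_of_def)
  finally show "act_right (L + 1) (P n) (op_E L) $$ (a, j) = (mp_const (Lambda_E L n) * P n) $$ (a, j)"
    using act_right_index[OF c aj L] by simp
next
  have c: "P n \<in> carrier_mat (L + 1) (L + 1)"
    using mo by (simp add: monic_orthogonal_def monic_mp_def)
  show "dim_row (act_right (L + 1) (P n) (op_E L)) = dim_row (mp_const (Lambda_E L n) * P n)"
    "dim_col (act_right (L + 1) (P n) (op_E L)) = dim_col (mp_const (Lambda_E L n) * P n)"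
    using carrier_matD[OF c] carrier_matD[OF act_right_carrier[of "L
      + 1" "P n" "op_E L"]] carrier_matD[OF Lambda_E_carrier[of L n]]
    by (simp_all add: mp_const_def)
qed

theorem theorem7p5:
  fixes L :: nat
  assumes "L > 0"
  shows "symmetric_diffop (L + 1) (weight L) (op_E L)
    \<and> op_E L \<in> diffop_algebra (L + 1) (weight L)
    \<and> (\<forall>P. monic_orthogonal (L + 1) (weight L) P \<longrightarrow>
         (\<forall>n. act_right (L + 1) (P n) (op_E L) = mp_const (Lambda_E L n) * P n))"
proof -
  have "op_E L \<in> diffop_algebra (L + 1) (weight L)"
    unfolding diffop_algebra_def
    using op_E_is_diffop[OF assms] op_E_eigen[OF _ assms] Lambda_E_carrier by blast
  then show ?thesis using op_E_symmetric[OF assms] op_E_eigen[OF _ assms] by blast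
qed

end
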